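(* Assume (A1)–(A3) of the context hold for the problem $\phi_*=\min\{\phi(z):=g(z)+h(z):z\in\mathbb{R}^n\}$, and let a tolerance $\hat\rho>0$, $z_0\in\operatorname{dom}h$ and $\sigma\in(0,1)$ be given. Let $(\lambda,z^-,z,w,\varepsilon)$ be the output of the AIPP method (described in the context) with inputs $z_0$, $\sigma$, $(m,M)$, $\lambda=1/(2m)$ and $$(\bar\rho,\bar\varepsilon):=\left(\frac{\hat\rho}{4},\ \frac{\hat\rho^2}{32(M+2m)}\right).$$ Then: (a) the AIPP method terminates in at most $$\mathcal{O}\left\{\sqrt{\frac Mm}\left(\frac{m^2R(\phi;\lambda)}{\hat\rho^2}+\log_1^+\left(\frac Mm\right)\right)\right\}$$ inner (ACG) iterations, where the constant hidden in $\mathcal{O}(\cdot)$ depends only on $\sigma$ and $$R(\phi;\lambda):=\inf\left\{\tfrac12\|z_0-u\|^2+(1-\sigma)\lambda[\phi(u)-\phi_*]:u\in\mathbb{R}^n\right\};$$ (b) if $\nabla g$ is $M$-Lipschitz continuous on $\operatorname{dom}h$, then the pair $(\hat z,\hat v)=(z_g,v_g)$ computed as $$z_g:=\operatorname{argmin}_u\left\{\ell_g(u;z)+h(u)+\frac{M+\lambda^{-1}}2\|u-z\|^2\right\},\qquad v_g:=(M+\lambda^{-1})(z-z_g)+\nabla g(z_g)-\nabla g(z)$$ satisfies $\hat v\in\nabla g(\hat z)+\partial h(\hat z)$ and $\|\hat v\|\le\hat\rho$.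
   Context: Notation: $\log_1^+(t):=\max\{\log t,1\}$ for $t>0$; $\ell_\psi(u;z):=\psi(z)+\langle\nabla\psi(z),u-z\rangle$. For $\psi:\mathbb{R}^n\to(-\infty,\infty]$, $\varepsilon\ge0$, $z\in\operatorname{dom}\psi$, $\partial_\varepsilon\psi(z):=\{v:\psi(u)\ge\psi(z)+\langle v,u-z\rangle-\varepsilon\ \forall u\in\mathbb{R}^n\}$ (no convexity of $\psi$ required), $\partial\psi:=\partial_0\psi$. The function $\phi=g+h$ is $+\infty$ outside $\operatorname{dom}h$. Assumptions: (A1) $h:\mathbb{R}^n\to(-\infty,\infty]$ is proper, lower semicontinuous and convex; (A2) $g$ is differentiable on $\operatorname{dom}h$ and, for some $M\ge m>0$, $-\frac m2\|u-z\|^2\le g(u)-\ell_g(u;z)\le\frac M2\|u-z\|^2$ for all $z,u\in\operatorname{dom}h$; (A3) $\phi_*:=\inf_{z}\phi(z)>-\infty$. ACG method. Applied to $\min_x\{\psi(x):=\psi_s(x)+\psi_n(x)\}$, where $\psi_n$ is proper closed $\mu$-strongly convex and $\psi_s$ is convex, differentiable on $\operatorname{dom}\psi_n$ with $\psi_s(u)-\ell_{\psi_s}(u;x)\le\frac L2\|u-x\|^2$ on $\operatorname{dom}\psi_n$, from a starting point $x_0\in\operatorname{dom}\psi_n$: set $y_0=x_0$, $A_0=0$, $\Gamma_0\equiv0$, and for $j=0,1,2,\dots$ compute $A_{j+1}=A_j+\frac{\mu A_j+1+\sqrt{(\mu A_j+1)^2+4L(\mu A_j+1)A_j}}{2L}$,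 $\tilde x_j=\frac{A_j}{A_{j+1}}x_j+\frac{A_{j+1}-A_j}{A_{j+1}}y_j$, $\Gamma_{j+1}=\frac{A_j}{A_{j+1}}\Gamma_j+\frac{A_{j+1}-A_j}{A_{j+1}}\ell_{\psi_s}(\cdot;\tilde x_j)$, $y_{j+1}=\operatorname{argmin}_y\{\Gamma_{j+1}(y)+\psi_n(y)+\frac{1}{2A_{j+1}}\|y-y_0\|^2\}$, $x_{j+1}=\frac{A_j}{A_{j+1}}x_j+\frac{A_{j+1}-A_j}{A_{j+1}}y_{j+1}$, $u_{j+1}=\frac{y_0-y_{j+1}}{A_{j+1}}$, $\eta_{j+1}=\psi(x_{j+1})-\Gamma_{j+1}(y_{j+1})-\psi_n(y_{j+1})-\langle u_{j+1},x_{j+1}-y_{j+1}\rangle$. Each such pass is one ACG (inner) iteration, producing the triple $(x_{j+1},u_{j+1},\eta_{j+1})$. AIPP method. Inputs: $z_0\in\operatorname{dom}h$, $\sigma\in(0,1)$, $(m,M)$ as in (A2), $0<\lambda\le1/(2m)$, tolerances $(\bar\rho,\bar\varepsilon)$ with $\bar\rho,\bar\varepsilon>0$. Set $k=1$. Step 1: run the ACG method from $x_0=z_{k-1}$ with $\psi_s=\lambda g+\frac14\|\cdot-z_{k-1}\|^2$, $\psi_n=\lambda h+\frac14\|\cdot-z_{k-1}\|^2$ (with $\mu=1/2$, $L=\lambda M+1/2$) for at least $\lceil6\sqrt{2\lambda M+1}\rceil$ iterations, and until a triple $(x,u,\eta)$ is obtained with $u\in\partial_\eta(\lambda(g+h)+\frac12\|\cdot-z_{k-1}\|^2)(x)$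 and $\|u\|^2+2\eta\le\sigma\|z_{k-1}-x+u\|^2$ (the inclusion holds for every ACG iterate, so only the inequality is checked). Step 2: if $\|z_{k-1}-x+u\|\le\lambda\bar\rho/5$, go to Step 3; otherwise set $(z_k,\tilde v_k,\tilde\varepsilon_k)=(x,u,\eta)$, $k\leftarrow k+1$ and go to Step 1. Step 3: continue the last ACG run until an iterate $(\tilde x,\tilde u,\tilde\eta)$ is found satisfying the two conditions of Step 1 (with $(x,u,\eta)$ replaced by $(\tilde x,\tilde u,\tilde\eta)$) and $\tilde\eta/\lambda\le\bar\varepsilon$; set $(z_k,\tilde v_k,\tilde\varepsilon_k)=(\tilde x,\tilde u,\tilde\eta)$ and output $(\lambda,z^-,z,w,\varepsilon)=(\lambda,z_{k-1},z_k,\tilde v_k/\lambda,\tilde\varepsilon_k/\lambda)$. The number of inner iterations is the total number of ACG iterations performed in Steps 1 and 3. *)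

theory Defs
  imports "HOL-Analysis.Analysis"
begin

section \<open>The spaces of \<open>n\<close>-vectors inside one inner product space\<close>

text \<open>
  The complexity bound has a constant that must not depend on the dimension, so the dimension
  has to be quantified inside the statement and cannot be a type. All spaces \<open>R^n\<close> are therefore
  realised as the subspaces \<open>Rn n\<close> of the single inner product space \<open>rseq\<close> of finitely supported
  real sequences (standard inner product, Euclidean norm). Functions on \<open>R^n\<close> are functions
  on \<open>rseq\<close> whose values outside \<open>Rn n\<close> are never used.
\<close>

typedef rseq = "{x :: nat \<Rightarrow> real. finite {i. x i \<noteq> 0}}"
  morphisms coord Abs_rseq
  by (rule exI[of _ "\<lambda>_. 0"]) simp

setup_lifting type_definition_rseq

lemma finite_coord [simp]: "finite {i. coord x i \<noteq> 0}"
  using coord by auto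

lemma rseq_eqI: "(\<And>i. coord x i = coord y i) \<Longrightarrow> x = y"
  by (metis coord_inject ext)

instantiation rseq :: real_vector
begin

lift_definition zero_rseq :: rseq is "\<lambda>_. 0" by simp

lift_definition plus_rseq :: "rseq \<Rightarrow> rseq \<Rightarrow> rseq" is "\<lambda>x y i. x i + y i"
proof -
  fix x y :: "nat \<Rightarrow> real"
  assume "finite {i. x i \<noteq> 0}" "finite {i. y i \<noteq> 0}"
  then have "finite ({i. x i \<noteq> 0} \<union> {i. y i \<noteq> 0})" by blast
  then show "finite {i. x i + y i \<noteq> 0}" by (rule rev_finite_subset) auto
qed

lift_definition minus_rseq :: "rseq \<Rightarrow> rseq \<Rightarrow> rseq" is "\<lambda>x y i. x i - y i"
proof -
  fix x y :: "nat \<Rightarrow> real"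
  assume "finite {i. x i \<noteq> 0}" "finite {i. y i \<noteq> 0}"
  then have "finite ({i. x i \<noteq> 0} \<union> {i. y i \<noteq> 0})" by blast
  then show "finite {i. x i - y i \<noteq> 0}" by (rule rev_finite_subset) auto
qed

lift_definition uminus_rseq :: "rseq \<Rightarrow> rseq" is "\<lambda>x i. - x i" by simp

lift_definition scaleR_rseq :: "real \<Rightarrow> rseq \<Rightarrow> rseq" is "\<lambda>c x i. c * x i"
  by (erule rev_finite_subset) auto

instance
  by standard (transfer; simp add: algebra_simps fun_eq_iff)+

end

instantiation rseq :: real_inner
begin

definition inner_rseq :: "rseq \<Rightarrow> rseq \<Rightarrow> real"
  where "inner_rseq x y = (\<Sum>i | coord x i \<noteq> 0. coord x i * coord y i)"

definition norm_rseq :: "rseq \<Rightarrow> real"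
  where "norm_rseq x = sqrt (x \<bullet> x)"

definition sgn_rseq :: "rseq \<Rightarrow> rseq"
  where "sgn_rseq x = x /\<^sub>R norm x"

definition dist_rseq :: "rseq \<Rightarrow> rseq \<Rightarrow> real"
  where "dist_rseq x y = norm (x - y)"

definition uniformity_rseq :: "(rseq \<times> rseq) filter"
  where "uniformity_rseq = (INF e\<in>{0 <..}. principal {(x, y). dist x y < e})"

definition open_rseq :: "rseq set \<Rightarrow> bool"
  where "open_rseq U \<longleftrightarrow> (\<forall>x\<in>U. eventually (\<lambda>(x', y). x' = x \<longrightarrow> y \<in> U) uniformity)"

lemma inner_rseq_superset:
  assumes "finite S" "{i. coord x i \<noteq> 0} \<subseteq> S"
  shows "x \<bullet> y = (\<Sum>i\<in>S. coord x i * coord y i)"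
  unfolding inner_rseq_def using assms by (intro sum.mono_neutral_left) auto

instance
proof
  fix x y z :: rseq and r :: real
  define S where "S = {i. coord x i \<noteq> 0} \<union> {i. coord y i \<noteq> 0} \<union> {i. coord z i \<noteq> 0}"
  have S: "finite S" by (simp add: S_def)
  have plus: "coord (x + y) i = coord x i + coord y i" for i by (simp add: plus_rseq.rep_eq)
  have scale: "coord (r *\<^sub>R x) i = r * coord x i" for i by (simp add: scaleR_rseq.rep_eq)
  have sub: "{i. coord (x + y) i \<noteq> 0} \<subseteq> S" "{i. coord (r *\<^sub>R x) i \<noteq> 0} \<subseteq> S"
    "{i. coord x i \<noteq> 0} \<subseteq> S" "{i. coord y i \<noteq> 0} \<subseteq> S"
    by (auto simp: S_def plus scale)
  note exp = inner_rseq_superset[OF S sub(1)] inner_rseq_superset[OF S sub(2)]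
    inner_rseq_superset[OF S sub(3)] inner_rseq_superset[OF S sub(4)]
  show "dist x y = norm (x - y)" by (rule dist_rseq_def)
  show "sgn x = x /\<^sub>R norm x" by (rule sgn_rseq_def)
  show "(uniformity :: (rseq \<times> rseq) filter) = (INF e\<in>{0 <..}. principal {(x, y). dist x y < e})"
    by (rule uniformity_rseq_def)
  show "open U \<longleftrightarrow> (\<forall>x\<in>U. eventually (\<lambda>(x', y). x' = x \<longrightarrow> y \<in> U) uniformity)" for U :: "rseq set"
    by (rule open_rseq_def)
  show "x \<bullet> y = y \<bullet> x" by (simp add: exp mult.commute)
  show "(x + y) \<bullet> z = x \<bullet> z + y \<bullet> z"
    by (simp add: exp plus sum.distrib algebra_simps)
  show "(r *\<^sub>R x) \<bullet> y = r * (x \<bullet> y)"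
    by (simp add: exp scale sum_distrib_left algebra_simps)
  show "0 \<le> x \<bullet> x" by (simp add: inner_rseq_def sum_nonneg)
  have "(x \<bullet> x = 0) = (\<forall>i\<in>{i. coord x i \<noteq> 0}. coord x i * coord x i = 0)"
    unfolding inner_rseq_def by (rule sum_nonneg_eq_0_iff) auto
  also have "\<dots> = (\<forall>i. coord x i = 0)" by auto
  also have "\<dots> = (x = 0)" by (auto simp: zero_rseq.rep_eq intro: rseq_eqI)
  finally show "(x \<bullet> x = 0) = (x = 0)" .
  show "norm x = sqrt (x \<bullet> x)" by (rule norm_rseq_def)
qed

end

definition Rn :: "nat \<Rightarrow> rseq set"
  where "Rn n = {x. \<forall>i\<ge>n. coord x i = 0}"


section \<open>Extended-valued functions, gradients and subdifferentials on \<open>R^n\<close>\<close>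

definition eff_dom :: "nat \<Rightarrow> (rseq \<Rightarrow> ereal) \<Rightarrow> rseq set"
  where "eff_dom n f = {x \<in> Rn n. f x < \<infinity>}"

definition proper :: "nat \<Rightarrow> (rseq \<Rightarrow> ereal) \<Rightarrow> bool"
  where "proper n f \<longleftrightarrow> (\<forall>x\<in>Rn n. f x \<noteq> - \<infinity>) \<and> (\<exists>x\<in>Rn n. f x \<noteq> \<infinity>)"

definition lower_semicontinuous :: "nat \<Rightarrow> (rseq \<Rightarrow> ereal) \<Rightarrow> bool"
  where "lower_semicontinuous n f \<longleftrightarrow> (\<forall>x\<in>Rn n. f x \<le> Liminf (at x within Rn n) f)"

definition convex_fun :: "nat \<Rightarrow> (rseq \<Rightarrow> ereal) \<Rightarrow> bool"
  where "convex_fun n f \<longleftrightarrow>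
    (\<forall>x\<in>Rn n. \<forall>y\<in>Rn n. \<forall>t\<in>{0<..<1}.
       f ((1 - t) *\<^sub>R x + t *\<^sub>R y) \<le> ereal (1 - t) * f x + ereal t * f y)"

text \<open>
  The gradient is the Riesz representative, in \<open>R^n\<close>, of the Frechet derivative in \<open>R^n\<close>
  (the filter \<open>at x within Rn n\<close> is the filter of punctured \<open>R^n\<close>-neighbourhoods of \<open>x\<close>).
\<close>

definition grad :: "nat \<Rightarrow> (rseq \<Rightarrow> real) \<Rightarrow> rseq \<Rightarrow> rseq"
  where "grad n f x = (THE D. D \<in> Rn n \<and> (f has_derivative (\<lambda>d. D \<bullet> d)) (at x within Rn n))"

definition linearization :: "nat \<Rightarrow> (rseq \<Rightarrow> real) \<Rightarrow> rseq \<Rightarrow> rseq \<Rightarrow> real"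
  where "linearization n f u z = f z + grad n f z \<bullet> (u - z)"

definition eps_subdifferential :: "nat \<Rightarrow> real \<Rightarrow> (rseq \<Rightarrow> ereal) \<Rightarrow> rseq \<Rightarrow> rseq set"
  where "eps_subdifferential n e f z =
    {v \<in> Rn n. z \<in> eff_dom n f \<and> (\<forall>u\<in>Rn n. f u \<ge> f z + ereal (v \<bullet> (u - z)) - ereal e)}"

abbreviation subdifferential :: "nat \<Rightarrow> (rseq \<Rightarrow> ereal) \<Rightarrow> rseq \<Rightarrow> rseq set"
  where "subdifferential n f z \<equiv> eps_subdifferential n 0 f z"


section \<open>The composite problem and its standing assumptions\<close>

definition phi :: "(rseq \<Rightarrow> real) \<Rightarrow> (rseq \<Rightarrow> ereal) \<Rightarrow> rseq \<Rightarrow> ereal"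
  where "phi g h z = ereal (g z) + h z"

definition phi_inf :: "nat \<Rightarrow> (rseq \<Rightarrow> real) \<Rightarrow> (rseq \<Rightarrow> ereal) \<Rightarrow> ereal"
  where "phi_inf n g h = (INF z\<in>Rn n. phi g h z)"

definition A1 :: "nat \<Rightarrow> (rseq \<Rightarrow> ereal) \<Rightarrow> bool"
  where "A1 n h \<longleftrightarrow> proper n h \<and> lower_semicontinuous n h \<and> convex_fun n h"

definition A2 :: "nat \<Rightarrow> (rseq \<Rightarrow> real) \<Rightarrow> (rseq \<Rightarrow> ereal) \<Rightarrow> real \<Rightarrow> real \<Rightarrow> bool"
  where "A2 n g h m M \<longleftrightarrow> M \<ge> m \<and> m > 0 \<and>
    (\<forall>z\<in>eff_dom n h. g differentiable (at z within Rn n)) \<and>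
    (\<forall>z\<in>eff_dom n h. \<forall>u\<in>eff_dom n h.
       - (m / 2) * (norm (u - z))\<^sup>2 \<le> g u - linearization n g u z \<and>
       g u - linearization n g u z \<le> M / 2 * (norm (u - z))\<^sup>2)"

definition A3 :: "nat \<Rightarrow> (rseq \<Rightarrow> real) \<Rightarrow> (rseq \<Rightarrow> ereal) \<Rightarrow> bool"
  where "A3 n g h \<longleftrightarrow> phi_inf n g h > - \<infinity>"

definition R_phi :: "nat \<Rightarrow> (rseq \<Rightarrow> real) \<Rightarrow> (rseq \<Rightarrow> ereal) \<Rightarrow> real \<Rightarrow> rseq \<Rightarrow> real \<Rightarrow> ereal"
  where "R_phi n g h \<sigma> z0 l =
    (INF u\<in>Rn n. ereal (1 / 2 * (norm (z0 - u))\<^sup>2)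
                  + ereal ((1 - \<sigma>) * l) * (phi g h u - phi_inf n g h))"

definition log1_plus :: "real \<Rightarrow> real"
  where "log1_plus t = max (ln t) 1"


section \<open>The ACG method\<close>

record acg_state =
  acg_A :: real
  acg_x :: rseq
  acg_y :: rseq
  acg_Gamma :: "rseq \<Rightarrow> real"

definition acg_step ::
  "nat \<Rightarrow> (rseq \<Rightarrow> real) \<Rightarrow> (rseq \<Rightarrow> ereal) \<Rightarrow> real \<Rightarrow> real \<Rightarrow> rseq \<Rightarrow> acg_state \<Rightarrow> acg_state"
  where "acg_step n psi_s psi_n \<mu> L y0 s =
    (let A = acg_A s; x = acg_x s; y = acg_y s; \<Gamma> = acg_Gamma s;
         A' = A + (\<mu> * A + 1 + sqrt ((\<mu> * A + 1)\<^sup>2 + 4 * L * (\<mu> * A + 1) * A)) / (2 * L);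
         x_tilde = (A / A') *\<^sub>R x + ((A' - A) / A') *\<^sub>R y;
         \<Gamma>' = (\<lambda>u. A / A' * \<Gamma> u + (A' - A) / A' * linearization n psi_s u x_tilde);
         y' = arg_min_on (\<lambda>u. ereal (\<Gamma>' u) + psi_n u
                               + ereal (1 / (2 * A') * (norm (u - y0))\<^sup>2)) (Rn n);
         x' = (A / A') *\<^sub>R x + ((A' - A) / A') *\<^sub>R y'
     in \<lparr>acg_A = A', acg_x = x', acg_y = y', acg_Gamma = \<Gamma>'\<rparr>)"

definition acg ::
  "nat \<Rightarrow> (rseq \<Rightarrow> real) \<Rightarrow> (rseq \<Rightarrow> ereal) \<Rightarrow> real \<Rightarrow> real \<Rightarrow> rseq \<Rightarrow> nat \<Rightarrow> acg_state"
  where "acg n psi_s psi_n \<mu> L x0 j =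
    (acg_step n psi_s psi_n \<mu> L x0 ^^ j)
      \<lparr>acg_A = 0, acg_x = x0, acg_y = x0, acg_Gamma = (\<lambda>_. 0)\<rparr>"

text \<open>
  The triple \<open>(x\<^sub>j, u\<^sub>j, \<eta>\<^sub>j)\<close> produced by iteration \<open>j\<close>; meaningful for \<open>j \<ge> 1\<close> only.
  The argument of \<open>real_of_ereal\<close> is finite along any run from a point of the domain.
\<close>

definition acg_triple ::
  "nat \<Rightarrow> (rseq \<Rightarrow> real) \<Rightarrow> (rseq \<Rightarrow> ereal) \<Rightarrow> real \<Rightarrow> real \<Rightarrow> rseq \<Rightarrow> nat \<Rightarrow> rseq \<times> rseq \<times> real"
  where "acg_triple n psi_s psi_n \<mu> L x0 j =
    (let s = acg n psi_s psi_n \<mu> L x0 j; x = acg_x s; y = acg_y s;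
         u = (1 / acg_A s) *\<^sub>R (x0 - y);
         \<eta> = real_of_ereal (ereal (psi_s x) + psi_n x - ereal (acg_Gamma s y) - psi_n y
                             - ereal (u \<bullet> (x - y)))
     in (x, u, \<eta>))"


section \<open>The AIPP method\<close>

definition aipp_triple ::
  "nat \<Rightarrow> (rseq \<Rightarrow> real) \<Rightarrow> (rseq \<Rightarrow> ereal) \<Rightarrow> real \<Rightarrow> real \<Rightarrow> rseq \<Rightarrow> nat \<Rightarrow> rseq \<times> rseq \<times> real"
  where "aipp_triple n g h M l c j =
    acg_triple n
      (\<lambda>w. l * g w + 1 / 4 * (norm (w - c))\<^sup>2)
      (\<lambda>w. ereal l * h w + ereal (1 / 4 * (norm (w - c))\<^sup>2))
      (1 / 2) (l * M + 1 / 2) c j"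

definition aipp_accepts ::
  "nat \<Rightarrow> (rseq \<Rightarrow> real) \<Rightarrow> (rseq \<Rightarrow> ereal) \<Rightarrow> real \<Rightarrow> real \<Rightarrow> rseq \<Rightarrow> rseq \<times> rseq \<times> real \<Rightarrow> bool"
  where "aipp_accepts n g h l \<sigma> c = (\<lambda>(x, u, \<eta>).
    u \<in> eps_subdifferential n \<eta> (\<lambda>w. ereal l * phi g h w + ereal (1 / 2 * (norm (w - c))\<^sup>2)) x \<and>
    (norm u)\<^sup>2 + 2 * \<eta> \<le> \<sigma> * (norm (c - x + u))\<^sup>2)"

definition is_first :: "(nat \<Rightarrow> bool) \<Rightarrow> nat \<Rightarrow> bool"
  where "is_first P j \<longleftrightarrow> P j \<and> (\<forall>i<j. \<not> P i)"

text \<open>The ACG run of Step 1 with prox-center \<open>c\<close> ends at iteration \<open>j\<close>.\<close>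

definition aipp_step1_ends ::
  "nat \<Rightarrow> (rseq \<Rightarrow> real) \<Rightarrow> (rseq \<Rightarrow> ereal) \<Rightarrow> real \<Rightarrow> real \<Rightarrow> real \<Rightarrow> rseq \<Rightarrow> nat \<Rightarrow> bool"
  where "aipp_step1_ends n g h M l \<sigma> c =
    is_first (\<lambda>j. int j \<ge> \<lceil>6 * sqrt (2 * l * M + 1)\<rceil> \<and>
                   aipp_accepts n g h l \<sigma> c (aipp_triple n g h M l c j))"

text \<open>
  \<open>aipp_reaches \<dots> c N\<close>: the method started at \<open>z0\<close> enters Step 1 with prox-center \<open>c\<close>
  after a total of \<open>N\<close> inner iterations.
\<close>

inductive aipp_reaches ::
  "nat \<Rightarrow> (rseq \<Rightarrow> real) \<Rightarrow> (rseq \<Rightarrow> ereal) \<Rightarrow> real \<Rightarrow> real \<Rightarrow> real \<Rightarrow> real \<Rightarrow> rseq \<Rightarrow> rseq \<Rightarrow> nat \<Rightarrow> bool"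
  for n g h M l \<sigma> \<rho> z0
where
  start: "aipp_reaches n g h M l \<sigma> \<rho> z0 z0 0"
| continue: "aipp_reaches n g h M l \<sigma> \<rho> z0 x (N + j)"
    if "aipp_reaches n g h M l \<sigma> \<rho> z0 c N"
      and "aipp_step1_ends n g h M l \<sigma> c j"
      and "aipp_triple n g h M l c j = (x, u, \<eta>)"
      and "norm (c - x + u) > l * \<rho> / 5"

text \<open>
  \<open>aipp_outputs \<dots> (l, c, z, w, e) N\<close>: the method stops with output \<open>(l, c, z, w, e)\<close> after
  a total of \<open>N\<close> inner iterations. In Step 3 the iterate with which Step 1 ended is itself the
  first candidate, so \<open>j' = j\<close> (no further iteration) is possible.
\<close>

inductive aipp_outputs ::
  "nat \<Rightarrow> (rseq \<Rightarrow> real) \<Rightarrow> (rseq \<Rightarrow> ereal) \<Rightarrow> real \<Rightarrow> real \<Rightarrow> real \<Rightarrow> real \<Rightarrow> real \<Rightarrow> rseq \<Rightarrow>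
   real \<times> rseq \<times> rseq \<times> rseq \<times> real \<Rightarrow> nat \<Rightarrow> bool"
  for n g h M l \<sigma> \<rho> \<epsilon> z0
where
  stop: "aipp_outputs n g h M l \<sigma> \<rho> \<epsilon> z0 (l, c, z, (1 / l) *\<^sub>R v, e / l) (N + j')"
    if "aipp_reaches n g h M l \<sigma> \<rho> z0 c N"
      and "aipp_step1_ends n g h M l \<sigma> c j"
      and "aipp_triple n g h M l c j = (x, u, \<eta>)"
      and "norm (c - x + u) \<le> l * \<rho> / 5"
      and "is_first (\<lambda>i. i \<ge> j \<and> aipp_accepts n g h l \<sigma> c (aipp_triple n g h M l c i) \<and>
                         snd (snd (aipp_triple n g h M l c i)) / l \<le> \<epsilon>) j'"
      and "aipp_triple n g h M l c j' = (z, v, e)"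


section \<open>The refinement of the AIPP output\<close>

definition z_refined ::
  "nat \<Rightarrow> (rseq \<Rightarrow> real) \<Rightarrow> (rseq \<Rightarrow> ereal) \<Rightarrow> real \<Rightarrow> real \<Rightarrow> rseq \<Rightarrow> rseq"
  where "z_refined n g h M l z =
    arg_min_on (\<lambda>u. ereal (linearization n g u z) + h u
                     + ereal ((M + 1 / l) / 2 * (norm (u - z))\<^sup>2)) (Rn n)"

definition v_refined ::
  "nat \<Rightarrow> (rseq \<Rightarrow> real) \<Rightarrow> (rseq \<Rightarrow> ereal) \<Rightarrow> real \<Rightarrow> real \<Rightarrow> rseq \<Rightarrow> rseq"
  where "v_refined n g h M l z =
    (let zg = z_refined n g h M l z
     in (M + 1 / l) *\<^sub>R (z - zg) + grad n g zg - grad n g z)"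

end

theory Submission
  imports Defs
begin

text \<open>
  AIPP is an inexact proximal point method. With \<open>l = 1 / (2 m)\<close> the proximal subproblem
  \<open>l \<phi> + 1/2 |. - c|^2\<close> is \<open>1/2\<close>-strongly convex although \<open>\<phi>\<close> need not be convex, and it is solved by
  the accelerated method ACG.

  Accuracy of an ACG iterate is governed by the accumulated step size \<open>A\<close>. The estimate-sequence
  invariant (\<open>estimate_step\<close>) yields \<open>|A u + x - c|^2 + 2 A \<eta> \<le> |x - c|^2\<close> together with the
  approximate subgradient inclusion (\<open>acg_triple_properties\<close>). So \<open>u\<close> and \<open>\<eta>\<close> are small relative to
  \<open>x - c\<close> once \<open>A\<close> is large, and the relative test of Step 1 holds as soon as
  \<open>A \<ge> 18 / \<sigma>\<close> (\<open>acg_residual_accepted\<close>). Since \<open>A\<close> grows at least like \<open>j^2 / (4 L)\<close> with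
  \<open>L \<le> \<kappa> = M / m\<close>, every run of Step 1 costs \<open>O (sqrt \<kappa>)\<close> iterations, without a logarithm.

  Every accepted point decreases \<open>l \<phi>\<close> by \<open>(1 - \<sigma>) / 2\<close> times its squared residual
  (\<open>accepted_decrease\<close>), and a run that does not lead to Step 3 has a residual above \<open>l \<rho> / 5\<close>.
  Comparing the first accepted point with an arbitrary \<open>w\<close> (\<open>accepted_first\<close>) shows that there are
  \<open>O (m^2 R / \<rho>_hat^2)\<close> such runs beyond the first. Only the last subproblem has to reach an
  absolute tolerance for \<open>\<eta>\<close>. There \<open>A \<ge> \<kappa>\<close> suffices (\<open>step3_succeeds\<close>), and the geometric growth of
  \<open>A\<close> caused by strong convexity provides it after \<open>O (sqrt \<kappa> ln \<kappa>)\<close> more iterations. The three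
  counts add up to the complexity bound.

  For the refined pair the residual of the final iterate must be controlled, although it is only
  tested when Step 1 ends. All iterates with \<open>A \<ge> 18\<close> lie within half of their distance to \<open>c\<close> from
  the exact proximal point (\<open>acg_residual_distance\<close>), hence the residual grows at most by the factor
  \<open>15/4\<close> during Step 3 (\<open>aipp_residual_stable\<close>). This factor and the threshold \<open>l \<rho> / 5\<close> give
  \<open>|v_hat| \<le> \<rho>_hat\<close> in \<open>refinement\<close>.

  All minimizers in the argument exist by \<open>strongly_convex_attains_min\<close>: minimizing sequences of
  strongly convex functions are Cauchy, and \<open>R^n\<close> is complete.
\<close>

section \<open>Completeness and gradients in \<open>R^n\<close>\<close>

lemma coord_plus [simp]: "coord (x + y) i = coord x i + coord y i"
  by (simp add: plus_rseq.rep_eq)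

lemma coord_minus [simp]: "coord (x - y) i = coord x i - coord y i"
  by (simp add: minus_rseq.rep_eq)

lemma coord_scaleR [simp]: "coord (c *\<^sub>R x) i = c * coord x i"
  by (simp add: scaleR_rseq.rep_eq)

lemma coord_zero [simp]: "coord 0 i = 0"
  by (simp add: zero_rseq.rep_eq)

lemma subspace_Rn: "subspace (Rn n)"
  by (simp add: subspace_def Rn_def)

lemma inner_Rn: "x \<in> Rn n \<Longrightarrow> x \<bullet> y = (\<Sum>i<n. coord x i * coord y i)"
  by (rule inner_rseq_superset) (auto simp: Rn_def not_le[symmetric])

definition truncated :: "nat \<Rightarrow> (nat \<Rightarrow> real) \<Rightarrow> rseq"
  where "truncated n f = Abs_rseq (\<lambda>i. if i < n then f i else 0)"

lemma coord_truncated [simp]: "coord (truncated n f) i = (if i < n then f i else 0)"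
proof -
  have "finite {i. (if i < n then f i else 0) \<noteq> 0}"
    by (rule finite_subset[of _ "{..<n}"]) auto
  then show ?thesis by (simp add: truncated_def Abs_rseq_inverse)
qed

lemma truncated_in_Rn: "truncated n f \<in> Rn n"
  by (simp add: Rn_def)

lemma abs_coord_le_norm: "x \<in> Rn n \<Longrightarrow> \<bar>coord x i\<bar> \<le> norm x"
proof -
  assume x: "x \<in> Rn n"
  show ?thesis
  proof (cases "i < n")
    case True
    then have "(coord x i)\<^sup>2 \<le> (\<Sum>i<n. coord x i * coord x i)"
      using member_le_sum[of i "{..<n}" "\<lambda>i. coord x i * coord x i"]
      by (simp add: power2_eq_square)
    then show ?thesis
      using x by (simp add: norm_eq_sqrt_inner inner_Rn real_le_rsqrt)
  qed (use x in \<open>simp add: Rn_def\<close>)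
qed

text \<open>
  The existence of minimizers below rests on this: minimizing sequences of strongly convex functions
  are Cauchy.
\<close>
lemma complete_Rn: "complete (Rn n)"
  unfolding complete_def
proof (intro allI impI, elim conjE)
  fix f :: "nat \<Rightarrow> rseq"
  assume f: "\<forall>k. f k \<in> Rn n" and cauchy: "Cauchy f"
  have "convergent (\<lambda>k. coord (f k) i)" for i
  proof (subst Cauchy_convergent_iff[symmetric], rule metric_CauchyI)
    fix e :: real assume "e > 0"
    then obtain N where N: "\<forall>j\<ge>N. \<forall>k\<ge>N. dist (f j) (f k) < e"
      using cauchy by (meson metric_CauchyD)
    have "dist (coord (f j) i) (coord (f k) i) < e" if "j \<ge> N" "k \<ge> N" for j k
    proof -
      have "\<bar>coord (f j - f k) i\<bar> \<le> norm (f j - f k)"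
        using f by (intro abs_coord_le_norm[of _ n] subspace_diff[OF subspace_Rn]) auto
      then show ?thesis using N that by (auto simp: dist_norm intro: le_less_trans)
    qed
    then show "\<exists>N. \<forall>j\<ge>N. \<forall>k\<ge>N. dist (coord (f j) i) (coord (f k) i) < e" by blast
  qed
  then obtain l where l: "\<And>i. (\<lambda>k. coord (f k) i) \<longlonglongrightarrow> l i"
    unfolding convergent_def by metis
  have "(\<lambda>k. sqrt (\<Sum>i<n. (coord (f k) i - l i) * (coord (f k) i - l i)))
        \<longlonglongrightarrow> sqrt (\<Sum>i<n. (l i - l i) * (l i - l i))"
    by (intro tendsto_intros l)
  moreover have "norm (f k - truncated n l)
      = sqrt (\<Sum>i<n. (coord (f k) i - l i) * (coord (f k) i - l i))" for k
    using f subspace_diff[OF subspace_Rn, of "f k" n "truncated n l"]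
    by (simp add: norm_eq_sqrt_inner inner_Rn truncated_in_Rn)
  ultimately have "(\<lambda>k. norm (f k - truncated n l)) \<longlonglongrightarrow> 0" by simp
  then have "f \<longlonglongrightarrow> truncated n l"
    by (subst tendsto_dist_iff) (simp add: dist_norm)
  then show "\<exists>l\<in>Rn n. f \<longlonglongrightarrow> l"
    using truncated_in_Rn by blast
qed

text \<open>
  The line through \<open>z\<close> in direction \<open>D1 - D2\<close> stays inside \<open>R^n\<close>, and the ordinary derivative
  of \<open>f\<close> along it is unique; testing both representatives on that direction gives \<open>|D1 - D2| = 0\<close>.
\<close>
lemma has_gradient_unique:
  assumes z: "z \<in> Rn n" and D1: "D1 \<in> Rn n" and D2: "D2 \<in> Rn n"
    and f1: "(f has_derivative (\<lambda>d. D1 \<bullet> d)) (at z within Rn n)"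
    and f2: "(f has_derivative (\<lambda>d. D2 \<bullet> d)) (at z within Rn n)"
  shows "D1 = D2"
proof -
  define E where "E = D1 - D2"
  have E: "E \<in> Rn n" using D1 D2 by (simp add: E_def subspace_Rn subspace_diff)
  define \<gamma> where "\<gamma> = (\<lambda>t::real. z + t *\<^sub>R E)"
  have range: "\<gamma> ` UNIV \<subseteq> Rn n"
    using z E by (auto simp: \<gamma>_def subspace_Rn subspace_add subspace_scale)
  have \<gamma>': "(\<gamma> has_derivative (\<lambda>t. t *\<^sub>R E)) (at 0)"
    unfolding \<gamma>_def by (auto intro!: derivative_eq_intros)
  have "((\<lambda>t. f (\<gamma> t)) has_derivative (\<lambda>t. D \<bullet> (t *\<^sub>R E))) (at 0)"
    if "(f has_derivative (\<lambda>d. D \<bullet> d)) (at z within Rn n)" for D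
    using has_derivative_in_compose[OF \<gamma>', of f "\<lambda>d. D \<bullet> d"]
      has_derivative_subset[OF that range] by (simp add: \<gamma>_def)
  from has_derivative_unique[OF this[OF f1] this[OF f2]]
  have "D1 \<bullet> (1 *\<^sub>R E) = D2 \<bullet> (1 *\<^sub>R E)" by (rule fun_cong)
  then have "E \<bullet> E = 0" by (simp add: E_def inner_diff_left)
  then show ?thesis by (simp add: E_def)
qed

lemma grad_eqI:
  assumes "z \<in> Rn n" "D \<in> Rn n" "(f has_derivative (\<lambda>d. D \<bullet> d)) (at z within Rn n)"
  shows "grad n f z = D"
  unfolding grad_def using assms has_gradient_unique by (intro the_equality) blast+

text \<open>
  A derivative within a subspace only sees increments from the subspace, so its values on other
  directions may be changed at will.
\<close>
lemma has_derivative_change_within_subspace: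
  assumes S: "subspace S" and z: "z \<in> S" and f: "(f has_derivative f') (at z within S)"
    and f'': "bounded_linear f''" and eq: "\<And>d. d \<in> S \<Longrightarrow> f' d = f'' d"
  shows "(f has_derivative f'') (at z within S)"
proof -
  have "\<forall>\<^sub>F y in at z within S.
      (f y - f z - f' (y - z)) /\<^sub>R norm (y - z) = (f y - f z - f'' (y - z)) /\<^sub>R norm (y - z)"
    using S z eq by (auto simp: eventually_at_filter subspace_diff)
  from tendsto_cong[OF this] show ?thesis
    using f f'' unfolding has_derivative_at_within by blast
qed

text \<open>
  The Riesz representative of the derivative is the vector of its values on the coordinate
  directions; it defines the constant \<open>grad\<close> wherever the function is differentiable.
\<close>
lemma
  assumes z: "z \<in> Rn n" and f: "f differentiable (at z within Rn n)"
  shows grad_in_Rn: "grad n f z \<in> Rn n"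
    and has_derivative_grad: "(f has_derivative (\<lambda>d. grad n f z \<bullet> d)) (at z within Rn n)"
proof -
  obtain f' where f': "(f has_derivative f') (at z within Rn n)"
    using f by (auto simp: differentiable_def)
  define e where "e i = truncated n (\<lambda>k. if k = i then 1 else 0)" for i
  define D where "D = truncated n (\<lambda>i. f' (e i))"
  have D: "D \<in> Rn n" by (simp add: D_def truncated_in_Rn)
  have "f' d = D \<bullet> d" if d: "d \<in> Rn n" for d
  proof -
    interpret f': bounded_linear f' using f' by (rule has_derivative_bounded_linear)
    have coord_sum: "coord (\<Sum>i\<in>I. v i) k = (\<Sum>i\<in>I. coord (v i) k)" for I k and v :: "nat \<Rightarrow> rseq"
      by (induction I rule: infinite_finite_induct) auto
    have "d = (\<Sum>i<n. coord d i *\<^sub>R e i)"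
    proof (rule rseq_eqI)
      fix k
      have "coord (\<Sum>i<n. coord d i *\<^sub>R e i) k
          = (\<Sum>i<n. if i = k then (if k < n then coord d k else 0) else 0)"
        unfolding coord_sum by (rule sum.cong) (auto simp: e_def)
      then show "coord d k = coord (\<Sum>i<n. coord d i *\<^sub>R e i) k"
        using d by (simp add: Rn_def)
    qed
    then have "f' d = f' (\<Sum>i<n. coord d i *\<^sub>R e i)" by simp
    also have "\<dots> = (\<Sum>i<n. coord d i * f' (e i))"
      by (simp add: f'.sum f'.scaleR)
    also have "\<dots> = D \<bullet> d"
      by (simp add: inner_Rn[OF D]) (simp add: D_def mult.commute)
    finally show ?thesis .
  qed
  then have has: "(f has_derivative (\<lambda>d. D \<bullet> d)) (at z within Rn n)"
    using has_derivative_change_within_subspace[OF subspace_Rn z f' bounded_linear_inner_right] by blast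
  have "grad n f z = D" using grad_eqI z D has by blast
  then show "grad n f z \<in> Rn n" "(f has_derivative (\<lambda>d. grad n f z \<bullet> d)) (at z within Rn n)"
    using D has by auto
qed

text \<open>
  The smooth part of a proximal subproblem is of this form, with \<open>b = 1/4\<close>.
\<close>
lemma grad_regularized:
  assumes z: "z \<in> Rn n" and c: "c \<in> Rn n" and g: "g differentiable (at z within Rn n)"
  shows "grad n (\<lambda>w. l * g w + b * (norm (w - c))\<^sup>2) z = l *\<^sub>R grad n g z + (2 * b) *\<^sub>R (z - c)"
proof (rule grad_eqI[OF z])
  show "l *\<^sub>R grad n g z + (2 * b) *\<^sub>R (z - c) \<in> Rn n"
    using z c grad_in_Rn[OF z g] by (simp add: subspace_Rn subspace_add subspace_scale subspace_diff)
  show "((\<lambda>w. l * g w + b * (norm (w - c))\<^sup>2) has_derivative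
      (\<lambda>d. (l *\<^sub>R grad n g z + (2 * b) *\<^sub>R (z - c)) \<bullet> d)) (at z within Rn n)"
    unfolding power2_norm_eq_inner
    by (auto intro!: derivative_eq_intros has_derivative_grad[OF z g]
        simp: fun_eq_iff inner_commute algebra_simps)
qed

section \<open>Strongly convex functions\<close>

definition strongly_convex_on :: "real \<Rightarrow> 'a::real_inner set \<Rightarrow> ('a \<Rightarrow> real) \<Rightarrow> bool"
  where "strongly_convex_on \<mu> D p \<longleftrightarrow> (\<forall>x\<in>D. \<forall>y\<in>D. \<forall>t\<in>{0<..<1}.
    p ((1 - t) *\<^sub>R x + t *\<^sub>R y) \<le> (1 - t) * p x + t * p y - \<mu> / 2 * t * (1 - t) * (norm (x - y))\<^sup>2)"

lemma norm_convex_comb_sq: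
  fixes x y :: "'a::real_inner"
  shows "(norm ((1 - t) *\<^sub>R x + t *\<^sub>R y))\<^sup>2
    = (1 - t) * (norm x)\<^sup>2 + t * (norm y)\<^sup>2 - t * (1 - t) * (norm (x - y))\<^sup>2"
  by (simp add: power2_norm_eq_inner inner_commute algebra_simps)

lemma norm_sq_shift:
  fixes u z c :: "'a::real_inner"
  shows "(norm (u - c))\<^sup>2 = (norm (z - c))\<^sup>2 + 2 * ((z - c) \<bullet> (u - z)) + (norm (u - z))\<^sup>2"
  by (simp add: power2_norm_eq_inner inner_commute algebra_simps)

lemma strongly_convex_on_add:
  assumes "strongly_convex_on \<mu> D p" "strongly_convex_on \<nu> D q"
  shows "strongly_convex_on (\<mu> + \<nu>) D (\<lambda>u. p u + q u)"
  unfolding strongly_convex_on_def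
proof (intro ballI)
  fix x y and t :: real assume xy: "x \<in> D" "y \<in> D" "t \<in> {0<..<1}"
  show "p ((1 - t) *\<^sub>R x + t *\<^sub>R y) + q ((1 - t) *\<^sub>R x + t *\<^sub>R y) \<le>
    (1 - t) * (p x + q x) + t * (p y + q y) - (\<mu> + \<nu>) / 2 * t * (1 - t) * (norm (x - y))\<^sup>2"
    using assms[unfolded strongly_convex_on_def, rule_format, OF xy]
    by (simp add: field_simps)
qed

text \<open>
  Average the paraboloids that support \<open>q\<close> from below at the intermediate point. In this form the
  criterion applies both to quadratics and to \<open>l * g + 1/2 |. - c|^2\<close>, whose convexity comes from
  the lower curvature bound of a nonconvex \<open>g\<close>.
\<close>
lemma strongly_convex_on_if_support:
  assumes D: "convex D"
    and q: "\<And>z. z \<in> D \<Longrightarrow> \<exists>a. \<forall>u\<in>D. q u \<ge> q z + a \<bullet> (u - z) + \<mu> / 2 * (norm (u - z))\<^sup>2"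
  shows "strongly_convex_on \<mu> D q"
  unfolding strongly_convex_on_def
proof (intro ballI)
  fix x y and t :: real assume x: "x \<in> D" and y: "y \<in> D" and t: "t \<in> {0<..<1}"
  define w where "w = (1 - t) *\<^sub>R x + t *\<^sub>R y"
  have "w \<in> D" unfolding w_def using D x y t by (simp add: convexD)
  then obtain a where a: "\<And>u. u \<in> D \<Longrightarrow> q u \<ge> q w + a \<bullet> (u - w) + \<mu> / 2 * (norm (u - w))\<^sup>2"
    using q by blast
  have xw: "x - w = t *\<^sub>R (x - y)" and yw: "y - w = (t - 1) *\<^sub>R (x - y)"
    by (simp_all add: w_def algebra_simps)
  have "(1 - t) * (q w + a \<bullet> (x - w) + \<mu> / 2 * (norm (x - w))\<^sup>2)
      + t * (q w + a \<bullet> (y - w) + \<mu> / 2 * (norm (y - w))\<^sup>2) \<le> (1 - t) * q x + t * q y"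
    using t a[OF x] a[OF y] by (intro add_mono mult_left_mono) auto
  then show "q w \<le> (1 - t) * q x + t * q y - \<mu> / 2 * t * (1 - t) * (norm (x - y))\<^sup>2"
    unfolding xw yw by (simp add: power_mult_distrib) (simp add: power2_eq_square field_simps)
qed

lemma strongly_convex_on_scale:
  assumes "strongly_convex_on 0 D p" "0 \<le> c"
  shows "strongly_convex_on 0 D (\<lambda>u. c * p u)"
  unfolding strongly_convex_on_def
proof (intro ballI)
  fix x y and t :: real assume xy: "x \<in> D" "y \<in> D" "t \<in> {0<..<1}"
  have "p ((1 - t) *\<^sub>R x + t *\<^sub>R y) \<le> (1 - t) * p x + t * p y"
    using assms(1) xy by (auto simp: strongly_convex_on_def)
  from mult_left_mono[OF this assms(2)]
  show "c * p ((1 - t) *\<^sub>R x + t *\<^sub>R y) \<le>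
    (1 - t) * (c * p x) + t * (c * p y) - 0 / 2 * t * (1 - t) * (norm (x - y))\<^sup>2"
    by (simp add: algebra_simps)
qed

lemma strongly_convex_on_quadratic:
  "strongly_convex_on (2 * b) D (\<lambda>u. a \<bullet> u + d + b * (norm (u - c))\<^sup>2)"
  unfolding strongly_convex_on_def
proof (intro ballI)
  fix x y and t :: real
  have w: "(1 - t) *\<^sub>R x + t *\<^sub>R y - c = (1 - t) *\<^sub>R (x - c) + t *\<^sub>R (y - c)"
    by (simp add: algebra_simps)
  show "a \<bullet> ((1 - t) *\<^sub>R x + t *\<^sub>R y) + d + b * (norm ((1 - t) *\<^sub>R x + t *\<^sub>R y - c))\<^sup>2
    \<le> (1 - t) * (a \<bullet> x + d + b * (norm (x - c))\<^sup>2) + t * (a \<bullet> y + d + b * (norm (y - c))\<^sup>2)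
      - 2 * b / 2 * t * (1 - t) * (norm (x - y))\<^sup>2"
    unfolding w norm_convex_comb_sq by (simp add: algebra_simps)
qed

text \<open>
  Compare the minimizer \<open>y\<close> with the point at fraction \<open>t\<close> of the segment from \<open>y\<close> to \<open>u\<close>, divide
  by \<open>t\<close>, and let \<open>t\<close> tend to \<open>0\<close>. The resulting quadratic growth plays the role of a first-order
  optimality condition in everything that follows.
\<close>
lemma strongly_convex_min_growth:
  assumes D: "convex D" and p: "strongly_convex_on \<mu> D p"
    and y: "y \<in> D" and min: "\<And>u. u \<in> D \<Longrightarrow> p y \<le> p u" and u: "u \<in> D"
  shows "p y + \<mu> / 2 * (norm (u - y))\<^sup>2 \<le> p u"
proof -
  define c where "c = \<mu> / 2 * (norm (u - y))\<^sup>2"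
  have le: "(1 - t) * c \<le> p u - p y" if t: "t \<in> {0<..<1}" for t
  proof -
    have "p y \<le> p ((1 - t) *\<^sub>R y + t *\<^sub>R u)"
      using D y u t by (intro min) (simp add: convexD)
    also have "\<dots> \<le> (1 - t) * p y + t * p u - t * ((1 - t) * c)"
      using p[unfolded strongly_convex_on_def, rule_format, OF y u t]
      by (simp add: c_def norm_minus_commute algebra_simps)
    finally have "t * ((1 - t) * c) \<le> t * (p u - p y)" by (simp add: algebra_simps)
    then show ?thesis using t by simp
  qed
  have "((\<lambda>t. (1 - t) * c) \<longlongrightarrow> (1 - 0) * c) (at_right 0)"
    by (intro tendsto_intros)
  moreover have "\<forall>\<^sub>F t in at_right 0. (1 - t) * c \<le> p u - p y"
    by (auto simp: eventually_at_right[of 0 "1::real"] intro!: exI[of _ 1] le)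
  ultimately have "c \<le> p u - p y"
    using tendsto_upperbound[of _ _ "at_right (0::real)"] by fastforce
  then show ?thesis by (simp add: c_def)
qed

text \<open>
  A midpoint of two almost minimal points cannot go below the infimum, so strong convexity forces
  them to be close: minimizing sequences are Cauchy. The last hypothesis (a sequential form of lower
  semicontinuity that also keeps the limit in the domain) lets the limit inherit the infimum.
\<close>
lemma strongly_convex_attains_min:
  fixes p :: "'a::real_inner \<Rightarrow> real"
  assumes S: "complete S" "D \<subseteq> S" and D: "convex D" "D \<noteq> {}"
    and p: "strongly_convex_on \<mu> D p" "\<mu> > 0"
    and below: "bdd_below (p ` D)"
    and closed: "\<And>v x I. \<lbrakk>\<And>k. v k \<in> D; x \<in> S; v \<longlonglongrightarrow> x; (\<lambda>k. p (v k)) \<longlonglongrightarrow> I\<rbrakk> \<Longrightarrow> x \<in> D \<and> p x \<le> I"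
  shows "\<exists>y\<in>D. \<forall>u\<in>D. p y \<le> p u"
proof -
  define I where "I = Inf (p ` D)"
  have I_le: "I \<le> p u" if "u \<in> D" for u
    unfolding I_def using below that by (simp add: cInf_lower)
  have "\<exists>u\<in>D. p u < I + 1 / (real k + 1)" for k
    using D cInf_lessD[of "p ` D" "I + 1 / (real k + 1)"] by (auto simp: I_def)
  then obtain v where v: "\<And>k. v k \<in> D" "\<And>k. p (v k) < I + 1 / (real k + 1)"
    by metis
  have close: "\<mu> / 8 * (norm (v i - v j))\<^sup>2 \<le> 1 / (real N + 1)" if "i \<ge> N" "j \<ge> N" for i j N
  proof -
    have "I \<le> p ((1 - 1/2) *\<^sub>R v i + (1/2) *\<^sub>R v j)"
      using D v by (intro I_le) (simp add: convexD)
    also have "\<dots> \<le> (1 - 1/2) * p (v i) + 1/2 * p (v j) - \<mu> / 2 * (1/2) * (1 - 1/2) * (norm (v i - v j))\<^sup>2"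
      by (rule p(1)[unfolded strongly_convex_on_def, rule_format]) (use v in auto)
    finally have "\<mu> / 8 * (norm (v i - v j))\<^sup>2 \<le> (p (v i) + p (v j)) / 2 - I"
      by (simp add: field_simps)
    moreover have "p (v k) < I + 1 / (real N + 1)" if "k \<ge> N" for k
      using v(2)[of k] that frac_le[of 1 1 "real N + 1" "real k + 1"] by simp
    from this[OF that(1)] this[OF that(2)]
    have "(p (v i) + p (v j)) / 2 - I \<le> 1 / (real N + 1)" by (simp add: field_simps)
    ultimately show ?thesis by linarith
  qed
  have "Cauchy v"
  proof (rule metric_CauchyI)
    fix e :: real assume e: "e > 0"
    obtain N where N: "1 / (real N + 1) < \<mu> / 8 * e\<^sup>2"
      using nat_approx_posE[of "\<mu> / 8 * e\<^sup>2"] p e by (auto simp: add.commute)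
    have "dist (v i) (v j) < e" if "i \<ge> N" "j \<ge> N" for i j
    proof -
      have "\<mu> / 8 * (norm (v i - v j))\<^sup>2 < \<mu> / 8 * e\<^sup>2" using close[OF that] N by linarith
      then have "(norm (v i - v j))\<^sup>2 < e\<^sup>2" using p by simp
      from power2_less_imp_less[OF this] show ?thesis using e by (simp add: dist_norm)
    qed
    then show "\<exists>N. \<forall>i\<ge>N. \<forall>j\<ge>N. dist (v i) (v j) < e" by blast
  qed
  then obtain x where x: "x \<in> S" "v \<longlonglongrightarrow> x"
    using S v unfolding complete_def by blast
  have "(\<lambda>k. p (v k)) \<longlonglongrightarrow> I"
  proof (rule tendsto_sandwich[of "\<lambda>_. I" _ _ "\<lambda>k. I + 1 / (real k + 1)"])
    have "(\<lambda>k. 1 / (real k + 1)) \<longlonglongrightarrow> 0"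
      using LIMSEQ_inverse_real_of_nat by (simp add: inverse_eq_divide add.commute)
    from tendsto_add[OF tendsto_const[of I] this]
    show "(\<lambda>k. I + 1 / (real k + 1)) \<longlonglongrightarrow> I" by simp
  qed (use v I_le in \<open>auto intro!: always_eventually less_imp_le tendsto_const\<close>)
  from closed[OF v(1) x this] show ?thesis
    using I_le by force
qed

section \<open>Closed convex functions and regularized minimization\<close>

definition fin_part :: "(rseq \<Rightarrow> ereal) \<Rightarrow> rseq \<Rightarrow> real"
  where "fin_part h u = real_of_ereal (h u)"

lemma ereal_fin_part: "A1 n h \<Longrightarrow> u \<in> eff_dom n h \<Longrightarrow> h u = ereal (fin_part h u)"
  by (cases "h u") (auto simp: fin_part_def A1_def proper_def eff_dom_def)

lemma eff_dom_subset: "eff_dom n h \<subseteq> Rn n"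
  by (auto simp: eff_dom_def)

lemma outside_eff_dom: "u \<in> Rn n \<Longrightarrow> u \<notin> eff_dom n h \<Longrightarrow> h u = \<infinity>"
  by (auto simp: eff_dom_def)

lemma eff_dom_nonempty: "A1 n h \<Longrightarrow> eff_dom n h \<noteq> {}"
  by (auto simp: A1_def proper_def eff_dom_def)

lemma convex_Rn: "convex (Rn n)"
  by (rule subspace_imp_convex[OF subspace_Rn])

lemma
  assumes h: "A1 n h"
  shows convex_eff_dom: "convex (eff_dom n h)"
    and convex_fin_part: "strongly_convex_on 0 (eff_dom n h) (fin_part h)"
proof -
  have *: "(1 - t) *\<^sub>R x + t *\<^sub>R y \<in> eff_dom n h \<and>
      fin_part h ((1 - t) *\<^sub>R x + t *\<^sub>R y) \<le> (1 - t) * fin_part h x + t * fin_part h y"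
    if x: "x \<in> eff_dom n h" and y: "y \<in> eff_dom n h" and t: "t \<in> {0<..<1}" for x y t
  proof -
    let ?w = "(1 - t) *\<^sub>R x + t *\<^sub>R y"
    have w: "?w \<in> Rn n" using x y t eff_dom_subset[of n h]
      by (intro convexD[OF convex_Rn]) auto
    have "h ?w \<le> ereal (1 - t) * h x + ereal t * h y"
      using h x y t eff_dom_subset[of n h] unfolding A1_def convex_fun_def by blast
    then have le: "h ?w \<le> ereal ((1 - t) * fin_part h x + t * fin_part h y)"
      by (simp add: ereal_fin_part[OF h x] ereal_fin_part[OF h y])
    then have "?w \<in> eff_dom n h" using w by (auto simp: eff_dom_def)
    with le show ?thesis by (simp add: ereal_fin_part[OF h])
  qed
  show "strongly_convex_on 0 (eff_dom n h) (fin_part h)"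
    unfolding strongly_convex_on_def using * by simp
  show "convex (eff_dom n h)"
  proof (unfold convex_alt, intro ballI allI impI)
    fix x y and t :: real
    assume "x \<in> eff_dom n h" "y \<in> eff_dom n h" "0 \<le> t \<and> t \<le> 1"
    then show "(1 - t) *\<^sub>R x + t *\<^sub>R y \<in> eff_dom n h"
      using * by (cases "t = 0 \<or> t = 1") auto
  qed
qed

lemma lsc_nearby:
  assumes h: "A1 n h" and x: "x \<in> Rn n" and C: "ereal C < h x"
  obtains e where "e > 0" "\<And>u. u \<in> Rn n \<Longrightarrow> dist u x < e \<Longrightarrow> ereal C < h u"
proof -
  have "h x \<le> Liminf (at x within Rn n) h"
    using h x by (auto simp: A1_def lower_semicontinuous_def)
  then have "\<forall>\<^sub>F u in at x within Rn n. ereal C < h u"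
    using C by (simp add: le_Liminf_iff)
  then obtain e where "e > 0" "\<And>u. u \<in> Rn n \<Longrightarrow> u \<noteq> x \<Longrightarrow> dist u x < e \<Longrightarrow> ereal C < h u"
    by (auto simp: eventually_at)
  then show ?thesis using that[of e] C by metis
qed

text \<open>
  Lower semicontinuity as it is used on minimizing sequences: a bound on the values along the
  sequence puts the limit into the effective domain and passes to its value.
\<close>
lemma closed_fin_part:
  assumes h: "A1 n h" and v: "\<And>k. v k \<in> eff_dom n h" and x: "x \<in> Rn n" and lim: "v \<longlonglongrightarrow> x"
    and B: "\<forall>\<^sub>F k in sequentially. fin_part h (v k) \<le> B"
  shows "x \<in> eff_dom n h \<and> fin_part h x \<le> B"
proof -
  have "\<not> ereal B < h x"
  proof
    assume "ereal B < h x"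
    then obtain e where e: "e > 0" "\<And>u. u \<in> Rn n \<Longrightarrow> dist u x < e \<Longrightarrow> ereal B < h u"
      using lsc_nearby[OF h x] by blast
    have "\<forall>\<^sub>F k in sequentially. dist (v k) x < e" using lim e(1) by (rule tendstoD)
    then have "\<forall>\<^sub>F k in sequentially. dist (v k) x < e \<and> fin_part h (v k) \<le> B"
      using B by (rule eventually_conj)
    then obtain k where "dist (v k) x < e" "fin_part h (v k) \<le> B"
      using eventually_happens'[OF sequentially_bot] by blast
    then show False using e(2)[of "v k"] v[of k] eff_dom_subset[of n h] by (auto simp: ereal_fin_part[OF h v])
  qed
  then have le: "h x \<le> ereal B" by simp
  then have "x \<in> eff_dom n h" using x by (auto simp: eff_dom_def)
  with le show ?thesis by (simp add: ereal_fin_part[OF h])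
qed

text \<open>
  Lower semicontinuity keeps \<open>h\<close> above \<open>h x0 - 1\<close> on a small ball around \<open>x0\<close>, and convexity along
  the ray from \<open>x0\<close> to \<open>u\<close>, which passes through that ball, propagates the bound with linear loss.
  A strongly convex term therefore dominates the negative part of \<open>h\<close>.
\<close>
lemma fin_part_linear_minorant:
  assumes h: "A1 n h" and x0: "x0 \<in> eff_dom n h"
  obtains K where "K \<ge> 0" "\<And>u. u \<in> eff_dom n h \<Longrightarrow> fin_part h u \<ge> fin_part h x0 - 1 - K * norm (u - x0)"
proof -
  have x0': "x0 \<in> Rn n" using x0 by (simp add: eff_dom_def)
  have "ereal (fin_part h x0 - 1) < h x0" by (simp add: ereal_fin_part[OF h x0])
  then obtain e where e: "e > 0" "\<And>u. u \<in> Rn n \<Longrightarrow> dist u x0 < e \<Longrightarrow> ereal (fin_part h x0 - 1) < h u"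
    using lsc_nearby[OF h x0'] by blast
  have near: "fin_part h x0 - 1 < fin_part h u" if "u \<in> eff_dom n h" "norm (u - x0) < e" for u
    using e(2)[of u] that ereal_fin_part[OF h that(1)] eff_dom_subset[of n h] by (auto simp: dist_norm)
  have "fin_part h u \<ge> fin_part h x0 - 1 - 2 / e * norm (u - x0)" if u: "u \<in> eff_dom n h" for u
  proof (cases "norm (u - x0) < e")
    case True
    moreover have "2 / e * norm (u - x0) \<ge> 0" using e by simp
    ultimately show ?thesis using near[OF u] by linarith
  next
    case False
    define r where "r = norm (u - x0)"
    have r: "r \<ge> e" "r > 0" using False e by (auto simp: r_def)
    \<comment> \<open>the point at fraction \<open>t\<close> lies at distance \<open>e / 2\<close> from \<open>x0\<close>\<close>
    define t where "t = e / (2 * r)"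
    have t: "t \<in> {0<..<1}" using r e by (auto simp: t_def field_simps)
    define w where "w = (1 - t) *\<^sub>R x0 + t *\<^sub>R u"
    have w: "w \<in> eff_dom n h"
      unfolding w_def using t x0 u by (intro convexD[OF convex_eff_dom[OF h]]) auto
    have "w - x0 = t *\<^sub>R (u - x0)" by (simp add: w_def algebra_simps)
    then have "norm (w - x0) = t * r" using t by (simp add: r_def)
    also have "\<dots> < e" using r e by (simp add: t_def)
    finally have "fin_part h x0 - 1 < fin_part h w" using near w by blast
    also have "\<dots> \<le> (1 - t) * fin_part h x0 + t * fin_part h u"
      using convex_fin_part[OF h] x0 u t by (auto simp: strongly_convex_on_def w_def)
    finally have "t * (fin_part h x0 - fin_part h u) < 1" by (simp add: algebra_simps)
    then have "fin_part h x0 - fin_part h u < 2 / e * r" using r e by (simp add: t_def field_simps)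
    then show ?thesis by (simp add: r_def)
  qed
  then show ?thesis using that[of "2 / e"] e by simp
qed

text \<open>
  The one existence result behind all minimization problems of the method: the ACG subproblems and
  the refinement step, where \<open>q\<close> is a quadratic, and the exact proximal point, where \<open>q\<close> contains
  the nonconvex \<open>g\<close>.
\<close>
lemma regularized_min:
  assumes h: "A1 n h" and \<kappa>: "\<kappa> > 0" and \<mu>: "\<mu> > 0"
    and q: "\<And>z. z \<in> eff_dom n h \<Longrightarrow>
      \<exists>a. \<forall>u\<in>eff_dom n h. q u \<ge> q z + a \<bullet> (u - z) + \<mu> / 2 * (norm (u - z))\<^sup>2"
    and cont: "\<And>z. z \<in> eff_dom n h \<Longrightarrow> continuous (at z within Rn n) q"
  shows "strongly_convex_on \<mu> (eff_dom n h) (\<lambda>u. \<kappa> * fin_part h u + q u)"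
    and "\<exists>y\<in>eff_dom n h. \<forall>u\<in>eff_dom n h. \<kappa> * fin_part h y + q y \<le> \<kappa> * fin_part h u + q u"
proof -
  let ?D = "eff_dom n h" and ?p = "\<lambda>u. \<kappa> * fin_part h u + q u"
  show sc: "strongly_convex_on \<mu> ?D ?p"
    using strongly_convex_on_add[OF strongly_convex_on_scale[OF convex_fin_part[OF h]]
        strongly_convex_on_if_support[OF convex_eff_dom[OF h] q]] \<kappa> by simp
  obtain x0 where x0: "x0 \<in> ?D" using eff_dom_nonempty[OF h] by blast
  obtain K where K: "K \<ge> 0" "\<And>u. u \<in> ?D \<Longrightarrow> fin_part h u \<ge> fin_part h x0 - 1 - K * norm (u - x0)"
    using fin_part_linear_minorant[OF h x0] by blast
  obtain a where a: "\<And>u. u \<in> ?D \<Longrightarrow> q u \<ge> q x0 + a \<bullet> (u - x0) + \<mu> / 2 * (norm (u - x0))\<^sup>2"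
    using q[OF x0] by blast
  have a': "q u \<ge> q x0 - norm a * norm (u - x0) + \<mu> / 2 * (norm (u - x0))\<^sup>2" if "u \<in> ?D" for u
    using a[OF that] Cauchy_Schwarz_ineq2[of a "u - x0"] by linarith
  show "\<exists>y\<in>?D. \<forall>u\<in>?D. ?p y \<le> ?p u"
  proof (rule strongly_convex_attains_min[OF complete_Rn eff_dom_subset convex_eff_dom[OF h]
        eff_dom_nonempty[OF h] sc \<mu>])
    define b where "b = \<kappa> * K + norm a"
    have "?p u \<ge> \<kappa> * (fin_part h x0 - 1) + q x0 - b\<^sup>2 / (2 * \<mu>)" if u: "u \<in> ?D" for u
    proof -
      define r where "r = norm (u - x0)"
      have "?p u \<ge> \<kappa> * (fin_part h x0 - 1 - K * r) + (q x0 - norm a * r + \<mu> / 2 * r\<^sup>2)"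
        unfolding r_def using \<kappa> K(2)[OF u] a'[OF u] by (intro add_mono mult_left_mono) auto
      also have "\<kappa> * (fin_part h x0 - 1 - K * r) + (q x0 - norm a * r + \<mu> / 2 * r\<^sup>2)
          = \<kappa> * (fin_part h x0 - 1) + q x0 - b * r + \<mu> / 2 * r\<^sup>2"
        by (simp add: b_def algebra_simps)
      moreover have "\<mu> / 2 * r\<^sup>2 - b * r + b\<^sup>2 / (2 * \<mu>) = \<mu> / 2 * (r - b / \<mu>)\<^sup>2"
        using \<mu> by (simp add: power2_diff field_simps power2_eq_square)
      moreover have "\<dots> \<ge> 0" using \<mu> by simp
      ultimately show ?thesis by linarith
    qed
    then show "bdd_below (?p ` ?D)" by (auto intro!: bdd_belowI)
  next
    fix v x I
    assume v: "\<And>k. v k \<in> ?D" and x: "x \<in> Rn n" and lim: "v \<longlonglongrightarrow> x" and I: "(\<lambda>k. ?p (v k)) \<longlonglongrightarrow> I"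
    have limq: "(\<lambda>k. q x0 - norm a * norm (v k - x0) + \<mu> / 2 * (norm (v k - x0))\<^sup>2)
        \<longlonglongrightarrow> q x0 - norm a * norm (x - x0) + \<mu> / 2 * (norm (x - x0))\<^sup>2" (is "_ \<longlonglongrightarrow> ?q0")
      by (intro tendsto_intros lim)
    have "\<forall>\<^sub>F k in sequentially. ?p (v k) < I + 1"
      using I by (rule order_tendstoD) simp
    moreover have "\<forall>\<^sub>F k in sequentially.
        q x0 - norm a * norm (v k - x0) + \<mu> / 2 * (norm (v k - x0))\<^sup>2 > ?q0 - 1"
      using limq by (rule order_tendstoD) simp
    ultimately have "\<forall>\<^sub>F k in sequentially. fin_part h (v k) \<le> (I + 1 - (?q0 - 1)) / \<kappa>"
    proof eventually_elim
      case (elim k)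
      then have "\<kappa> * fin_part h (v k) \<le> I + 1 - (?q0 - 1)" using a'[OF v[of k]] by linarith
      then show ?case using \<kappa> by (simp add: field_simps)
    qed
    from closed_fin_part[OF h v x lim this] have xD: "x \<in> ?D" by simp
    have limqx: "(\<lambda>k. q (v k)) \<longlonglongrightarrow> q x"
      using cont[OF xD] lim v eff_dom_subset[of n h]
      by (auto simp: continuous_within_sequentially o_def)
    have "?p x \<le> I + e" if e: "e > 0" for e
    proof -
      have "(\<lambda>k. (?p (v k) - q (v k)) / \<kappa>) \<longlonglongrightarrow> (I - q x) / \<kappa>"
        using \<kappa> by (intro tendsto_intros I limqx) auto
      then have "(\<lambda>k. fin_part h (v k)) \<longlonglongrightarrow> (I - q x) / \<kappa>" using \<kappa> by simp
      then have "\<forall>\<^sub>F k in sequentially. fin_part h (v k) < (I - q x) / \<kappa> + e / \<kappa>"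
        by (rule order_tendstoD) (use e \<kappa> in simp)
      then have "\<forall>\<^sub>F k in sequentially. fin_part h (v k) \<le> (I - q x) / \<kappa> + e / \<kappa>"
        by (rule eventually_mono) simp
      from closed_fin_part[OF h v x lim this] have "fin_part h x \<le> (I - q x + e) / \<kappa>"
        by (simp add: add_divide_distrib)
      then show ?thesis using \<kappa> by (simp add: field_simps)
    qed
    then show "x \<in> ?D \<and> ?p x \<le> I" using xD field_le_epsilon by blast
  qed
qed

lemma regularized_min_quadratic:
  assumes h: "A1 n h" and \<kappa>: "\<kappa> > 0" and b: "b > 0"
  shows "strongly_convex_on (2 * b) (eff_dom n h) (\<lambda>u. \<kappa> * fin_part h u + (a \<bullet> u + d + b * (norm (u - c))\<^sup>2))"
    and "\<exists>y\<in>eff_dom n h. \<forall>u\<in>eff_dom n h.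
      \<kappa> * fin_part h y + (a \<bullet> y + d + b * (norm (y - c))\<^sup>2)
      \<le> \<kappa> * fin_part h u + (a \<bullet> u + d + b * (norm (u - c))\<^sup>2)"
proof -
  let ?q = "\<lambda>u. a \<bullet> u + d + b * (norm (u - c))\<^sup>2"
  have b2: "0 < 2 * b" using b by simp
  have support: "\<exists>a'. \<forall>u\<in>eff_dom n h. ?q z + a' \<bullet> (u - z) + 2 * b / 2 * (norm (u - z))\<^sup>2 \<le> ?q u" for z
  proof (intro exI ballI)
    fix u
    show "?q z + (a + (2 * b) *\<^sub>R (z - c)) \<bullet> (u - z) + 2 * b / 2 * (norm (u - z))\<^sup>2 \<le> ?q u"
      unfolding norm_sq_shift[of u c z] by (simp add: algebra_simps)
  qed
  have cont: "continuous (at z within Rn n) ?q" for z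
    by (intro continuous_intros)
  show "strongly_convex_on (2 * b) (eff_dom n h) (\<lambda>u. \<kappa> * fin_part h u + ?q u)"
    by (rule regularized_min(1)[OF h \<kappa> b2 support cont])
  show "\<exists>y\<in>eff_dom n h. \<forall>u\<in>eff_dom n h. \<kappa> * fin_part h y + ?q y \<le> \<kappa> * fin_part h u + ?q u"
    by (rule regularized_min(2)[OF h \<kappa> b2 support cont])
qed

text \<open>
  \<open>arg_min_on\<close> is a choice operator, so its value is a minimizer only once one is known to exist.
\<close>
lemma arg_min_on_ereal:
  assumes D: "D \<subseteq> S" and F: "\<And>u. u \<in> D \<Longrightarrow> F u = ereal (p u)"
    and out: "\<And>u. u \<in> S \<Longrightarrow> u \<notin> D \<Longrightarrow> F u = \<infinity>"
    and ex: "\<exists>y\<in>D. \<forall>u\<in>D. p y \<le> p u"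
  shows "arg_min_on F S \<in> D \<and> (\<forall>u\<in>D. p (arg_min_on F S) \<le> p u)"
proof -
  obtain y where y: "y \<in> D" "\<And>u. u \<in> D \<Longrightarrow> p y \<le> p u" using ex by blast
  have "F y \<le> F u" if "u \<in> S" for u
    using y F out that by (cases "u \<in> D") auto
  then have "is_arg_min F (\<lambda>x. x \<in> S) y"
    using y D by (force simp: is_arg_min_def)
  then have "is_arg_min F (\<lambda>x. x \<in> S) (arg_min_on F S)"
    unfolding arg_min_on_def arg_min_def by (rule someI)
  then have S: "arg_min_on F S \<in> S" and min: "\<And>u. u \<in> S \<Longrightarrow> F (arg_min_on F S) \<le> F u"
    by (auto simp: is_arg_min_def not_less)
  have "F (arg_min_on F S) \<noteq> \<infinity>" using min[of y] y D F[of y] by auto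
  then have "arg_min_on F S \<in> D" using S out by blast
  moreover have "p (arg_min_on F S) \<le> p u" if "u \<in> D" for u
    using min[of u] F[of u] F[OF \<open>arg_min_on F S \<in> D\<close>] that D by auto
  ultimately show ?thesis by blast
qed

lemma eps_subdifferential_iff:
  assumes D: "D \<subseteq> Rn n" and F: "\<And>u. u \<in> D \<Longrightarrow> F u = ereal (p u)"
    and out: "\<And>u. u \<in> Rn n \<Longrightarrow> u \<notin> D \<Longrightarrow> F u = \<infinity>"
  shows "v \<in> eps_subdifferential n e F x \<longleftrightarrow>
    v \<in> Rn n \<and> x \<in> D \<and> (\<forall>w\<in>D. p x + v \<bullet> (w - x) - e \<le> p w)"
proof -
  have dom: "x \<in> eff_dom n F \<longleftrightarrow> x \<in> D" for x
    using D F[of x] out[of x] by (auto simp: eff_dom_def)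
  have "(\<forall>u\<in>Rn n. F u \<ge> F x + ereal (v \<bullet> (u - x)) - ereal e) \<longleftrightarrow>
      (\<forall>w\<in>D. p x + v \<bullet> (w - x) - e \<le> p w)" if x: "x \<in> D"
  proof
    assume *: "\<forall>u\<in>Rn n. F u \<ge> F x + ereal (v \<bullet> (u - x)) - ereal e"
    show "\<forall>w\<in>D. p x + v \<bullet> (w - x) - e \<le> p w"
    proof
      fix w assume w: "w \<in> D"
      then have "F w \<ge> F x + ereal (v \<bullet> (w - x)) - ereal e" using * D by blast
      then show "p x + v \<bullet> (w - x) - e \<le> p w" by (simp add: F x w)
    qed
  next
    assume *: "\<forall>w\<in>D. p x + v \<bullet> (w - x) - e \<le> p w"
    show "\<forall>u\<in>Rn n. F u \<ge> F x + ereal (v \<bullet> (u - x)) - ereal e"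
    proof
      fix u assume "u \<in> Rn n"
      then show "F u \<ge> F x + ereal (v \<bullet> (u - x)) - ereal e"
        using * out by (cases "u \<in> D") (auto simp: F x)
    qed
  qed
  then show ?thesis by (auto simp: eps_subdifferential_def dom)
qed

section \<open>Growth of the ACG step sizes\<close>

lemma acg_Suc:
  "acg n psi_s psi_n \<mu> L x0 (Suc j) = acg_step n psi_s psi_n \<mu> L x0 (acg n psi_s psi_n \<mu> L x0 j)"
  by (simp add: acg_def)

lemma acg_A_step:
  "acg_A (acg_step n psi_s psi_n \<mu> L x0 s) = acg_A s +
    (\<mu> * acg_A s + 1 + sqrt ((\<mu> * acg_A s + 1)\<^sup>2 + 4 * L * (\<mu> * acg_A s + 1) * acg_A s)) / (2 * L)"
  by (simp add: acg_step_def Let_def)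

text \<open>
  The update of \<open>A\<close> takes the positive root of \<open>L a^2 = \<tau> (A + a)\<close>. This equation is exactly what
  turns the growth of the old model into the quadratic error of the linearization.
\<close>
lemma acg_step_size:
  fixes A L \<tau> :: real
  assumes "A \<ge> 0" "\<tau> > 0" "L > 0"
  defines "a \<equiv> (\<tau> + sqrt (\<tau>\<^sup>2 + 4 * L * \<tau> * A)) / (2 * L)"
  shows "a > 0" and "L * a\<^sup>2 = \<tau> * (A + a)"
proof -
  define r where "r = sqrt (\<tau>\<^sup>2 + 4 * L * \<tau> * A)"
  have r: "r \<ge> 0" "r\<^sup>2 = \<tau>\<^sup>2 + 4 * L * \<tau> * A" using assms by (simp_all add: r_def)
  show "a > 0" using assms r by (simp add: a_def r_def[symmetric])
  have ra: "r = 2 * L * a - \<tau>" using assms by (simp add: a_def r_def)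
  have "(2 * L * a - \<tau>)\<^sup>2 = \<tau>\<^sup>2 + 4 * L * \<tau> * A" using r(2) ra by simp
  then have "4 * L * (L * a\<^sup>2) = 4 * L * (\<tau> * (A + a))"
    by (simp add: power2_eq_square algebra_simps)
  then show "L * a\<^sup>2 = \<tau> * (A + a)" using assms by simp
qed

text \<open>
  One step adds at least \<open>(1 + sqrt (4 L A)) / (2 L)\<close>, so \<open>sqrt A\<close> increases by at least
  \<open>1 / (2 sqrt L)\<close>.
\<close>
lemma acg_A_quadratic_growth:
  assumes "\<mu> \<ge> 0" "L > 0"
  shows "(real j)\<^sup>2 / (4 * L) \<le> acg_A (acg n psi_s psi_n \<mu> L x0 j)"
proof (induction j)
  case (Suc j)
  define A where "A = acg_A (acg n psi_s psi_n \<mu> L x0 j)"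
  define \<tau> where "\<tau> = \<mu> * A + 1"
  have le: "(real j)\<^sup>2 / (4 * L) \<le> A" using Suc by (simp add: A_def)
  then have A: "A \<ge> 0" using assms by (meson divide_nonneg_pos mult_pos_pos order_trans zero_le_power2 zero_less_numeral)
  have \<tau>: "\<tau> \<ge> 1" using assms A by (simp add: \<tau>_def)
  have "(real j)\<^sup>2 \<le> 4 * L * A" using le assms by (simp add: field_simps)
  also have "\<dots> \<le> 4 * L * \<tau> * A"
    using \<tau> A assms by (simp add: mult_right_mono)
  also have "\<dots> \<le> \<tau>\<^sup>2 + 4 * L * \<tau> * A" by simp
  finally have "real j \<le> sqrt (\<tau>\<^sup>2 + 4 * L * \<tau> * A)" by (simp add: real_le_rsqrt)
  with \<tau> have "(1 + real j) / (2 * L) \<le> (\<tau> + sqrt (\<tau>\<^sup>2 + 4 * L * \<tau> * A)) / (2 * L)"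
    using assms by (intro divide_right_mono) auto
  moreover have "(real (Suc j))\<^sup>2 / (4 * L) \<le> (real j)\<^sup>2 / (4 * L) + (1 + real j) / (2 * L)"
    using assms by (simp add: field_simps power2_eq_square)
  ultimately have "(real (Suc j))\<^sup>2 / (4 * L) \<le> A + (\<tau> + sqrt (\<tau>\<^sup>2 + 4 * L * \<tau> * A)) / (2 * L)"
    using le by linarith
  then show ?case by (simp add: acg_Suc acg_A_step A_def \<tau>_def)
qed (simp add: acg_def)

lemma acg_A_pos:
  assumes "\<mu> \<ge> 0" "L > 0" "j > 0"
  shows "acg_A (acg n psi_s psi_n \<mu> L x0 j) > 0"
proof -
  have "0 < (real j)\<^sup>2 / (4 * L)" using assms by simp
  then show ?thesis using acg_A_quadratic_growth[OF assms(1,2)] by (rule less_le_trans)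
qed

text \<open>
  With \<open>\<tau> \<ge> \<mu> A\<close>, the square root in the update alone contributes \<open>sqrt (\<mu> / L) * A\<close>.
\<close>
lemma acg_A_exponential_growth:
  assumes "\<mu> \<ge> 0" "L > 0"
  shows "(1 + sqrt (\<mu> / L)) ^ j / L \<le> acg_A (acg n psi_s psi_n \<mu> L x0 (Suc j))"
proof (induction j)
  case 0
  show ?case using assms by (simp add: acg_def acg_A_step)
next
  case (Suc j)
  define A where "A = acg_A (acg n psi_s psi_n \<mu> L x0 (Suc j))"
  define \<tau> where "\<tau> = \<mu> * A + 1"
  have A: "A > 0" unfolding A_def using assms by (intro acg_A_pos) auto
  have \<tau>: "\<tau> \<ge> 1" "\<tau> \<ge> \<mu> * A" using assms A by (simp_all add: \<tau>_def)
  have "(2 * L * (sqrt (\<mu> / L) * A))\<^sup>2 = 4 * L * (\<mu> * A) * A"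
    using assms by (simp add: power_mult_distrib) (simp add: power2_eq_square field_simps)
  also have "\<dots> \<le> 4 * L * \<tau> * A"
    using assms A \<tau> by (intro mult_right_mono mult_left_mono) auto
  also have "\<dots> \<le> \<tau>\<^sup>2 + 4 * L * \<tau> * A" by simp
  finally have "2 * L * (sqrt (\<mu> / L) * A) \<le> sqrt (\<tau>\<^sup>2 + 4 * L * \<tau> * A)"
    by (rule real_le_rsqrt)
  then have "2 * L * (sqrt (\<mu> / L) * A) \<le> \<tau> + sqrt (\<tau>\<^sup>2 + 4 * L * \<tau> * A)" using \<tau> by linarith
  then have "sqrt (\<mu> / L) * A \<le> (\<tau> + sqrt (\<tau>\<^sup>2 + 4 * L * \<tau> * A)) / (2 * L)"
    using assms by (simp add: field_simps)
  moreover have "(1 + sqrt (\<mu> / L)) * ((1 + sqrt (\<mu> / L)) ^ j / L) \<le> (1 + sqrt (\<mu> / L)) * A"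
    using Suc assms by (intro mult_left_mono) (auto simp: A_def)
  moreover have "(1 + sqrt (\<mu> / L)) * A = A + sqrt (\<mu> / L) * A"
    by (simp add: algebra_simps)
  ultimately have "(1 + sqrt (\<mu> / L)) ^ Suc j / L \<le> A + (\<tau> + sqrt (\<tau>\<^sup>2 + 4 * L * \<tau> * A)) / (2 * L)"
    by simp
  then show ?case by (simp add: acg_Suc[of _ _ _ _ _ _ "Suc j"] acg_A_step A_def \<tau>_def)
qed

section \<open>The estimate sequence of ACG\<close>

text \<open>
  Real-valued form of the problem to which ACG is applied: \<open>D\<close> is the domain of \<open>psi_n\<close> and \<open>N\<close>
  its finite values there.
\<close>
locale acg_problem =
  fixes n :: nat and psi_s N :: "rseq \<Rightarrow> real" and psi_n :: "rseq \<Rightarrow> ereal"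
    and \<mu> L :: real and x0 :: rseq and D :: "rseq set"
  assumes D: "convex D" "D \<subseteq> Rn n" and x0: "x0 \<in> D"
    and \<mu>: "\<mu> \<ge> 0" and L: "L > 0"
    and psi_n: "u \<in> D \<Longrightarrow> psi_n u = ereal (N u)"
      "u \<in> Rn n \<Longrightarrow> u \<notin> D \<Longrightarrow> psi_n u = \<infinity>"
    and N_convex: "strongly_convex_on \<mu> D N"
    and psi_s_convex: "z \<in> D \<Longrightarrow> u \<in> D \<Longrightarrow> linearization n psi_s u z \<le> psi_s u"
    and psi_s_smooth: "z \<in> D \<Longrightarrow> u \<in> D \<Longrightarrow>
      psi_s u \<le> linearization n psi_s u z + L / 2 * (norm (u - z))\<^sup>2"
    and prox_exists: "b > 0 \<Longrightarrow>
      \<exists>y\<in>D. \<forall>u\<in>D. a \<bullet> y + N y + b * (norm (y - x0))\<^sup>2 \<le> a \<bullet> u + N u + b * (norm (u - x0))\<^sup>2"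
begin

text \<open>
  The model \<open>A (\<Gamma> + psi_n) + 1/2 |. - x0|^2\<close> is the objective, scaled by \<open>A\<close>, that defines the
  point \<open>y\<close> of a state. Scaling keeps it meaningful at the start, where \<open>A = 0\<close>.
\<close>
definition model :: "acg_state \<Rightarrow> rseq \<Rightarrow> real"
  where "model s u = acg_A s * (acg_Gamma s u + N u) + 1 / 2 * (norm (u - x0))\<^sup>2"

text \<open>
  The estimate-sequence invariant of accelerated methods: \<open>\<Gamma>\<close> is an affine lower bound of the
  smooth part, \<open>y\<close> minimizes the model with the quadratic growth that its strong convexity
  provides, and the minimal model value is at least \<open>A\<close> times the objective value at \<open>x\<close>.
\<close>
definition estimate :: "acg_state \<Rightarrow> bool"
  where "estimate s \<longleftrightarrow> acg_A s \<ge> 0 \<and> acg_x s \<in> D \<and> acg_y s \<in> D \<and>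
    (\<exists>a d. \<forall>u. acg_Gamma s u = a \<bullet> u + d) \<and>
    (\<forall>u\<in>D. acg_A s * acg_Gamma s u \<le> acg_A s * psi_s u) \<and>
    (\<forall>u\<in>D. model s (acg_y s) + (\<mu> * acg_A s + 1) / 2 * (norm (u - acg_y s))\<^sup>2 \<le> model s u) \<and>
    acg_A s * (psi_s (acg_x s) + N (acg_x s)) \<le> model s (acg_y s)"

text \<open>
  The new model is the old one plus \<open>A' - A\<close> times linearization and nonsmooth part. At the new
  \<open>y'\<close>, the old model is at least \<open>A\<close> times the objective at \<open>x\<close> plus \<open>\<tau>/2 |y' - y|^2\<close>. By
  convexity the values at \<open>x\<close> and \<open>y'\<close> combine into a value at \<open>x'\<close>, and since
  \<open>x' - xt = \<theta> (y' - y)\<close> the choice of the step size makes the quadratic term equal to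
  \<open>A' L/2 |x' - xt|^2\<close>, which is precisely the error of the linearization at \<open>xt\<close>.
\<close>
lemma estimate_step:
  assumes s: "estimate s"
  shows "estimate (acg_step n psi_s psi_n \<mu> L x0 s)"
proof -
  define A where "A = acg_A s"
  define x where "x = acg_x s"
  define y where "y = acg_y s"
  define \<Gamma> where "\<Gamma> = acg_Gamma s"
  define \<tau> where "\<tau> = \<mu> * A + 1"
  define A' where "A' = A + (\<tau> + sqrt (\<tau>\<^sup>2 + 4 * L * \<tau> * A)) / (2 * L)"
  define \<theta> where "\<theta> = (A' - A) / A'"
  define xt where "xt = (A / A') *\<^sub>R x + \<theta> *\<^sub>R y"
  define \<Gamma>' where "\<Gamma>' = (\<lambda>u. A / A' * \<Gamma> u + \<theta> * linearization n psi_s u xt)"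
  define y' where "y' = arg_min_on (\<lambda>u. ereal (\<Gamma>' u) + psi_n u
                               + ereal (1 / (2 * A') * (norm (u - x0))\<^sup>2)) (Rn n)"
  define x' where "x' = (A / A') *\<^sub>R x + \<theta> *\<^sub>R y'"
  have step: "acg_step n psi_s psi_n \<mu> L x0 s
      = \<lparr>acg_A = A', acg_x = x', acg_y = y', acg_Gamma = \<Gamma>'\<rparr>"
    by (simp add: acg_step_def Let_def A_def x_def y_def \<Gamma>_def \<tau>_def A'_def \<theta>_def xt_def \<Gamma>'_def
        y'_def x'_def)
  have A: "A \<ge> 0" and x: "x \<in> D" and y: "y \<in> D"
    and lower: "\<And>u. u \<in> D \<Longrightarrow> A * \<Gamma> u \<le> A * psi_s u"
    and growth: "\<And>u. u \<in> D \<Longrightarrow> model s y + \<tau> / 2 * (norm (u - y))\<^sup>2 \<le> model s u"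
    and est: "A * (psi_s x + N x) \<le> model s y"
    using s by (simp_all add: estimate_def A_def x_def y_def \<Gamma>_def \<tau>_def)
  obtain a0 d0 where \<Gamma>_affine: "\<And>u. \<Gamma> u = a0 \<bullet> u + d0"
    using s by (auto simp: estimate_def \<Gamma>_def)
  have \<tau>: "\<tau> > 0" using A \<mu> by (simp add: \<tau>_def add_nonneg_pos)
  have "A' - A > 0" and sq: "L * (A' - A)\<^sup>2 = \<tau> * A'"
    using acg_step_size[OF A \<tau> L] by (simp_all add: A'_def)
  then have A': "A' > 0" and \<theta>: "0 < \<theta>" "\<theta> \<le> 1" "A / A' = 1 - \<theta>"
    using A by (simp_all add: \<theta>_def field_simps)
  have A\<theta>: "A = A' * (1 - \<theta>)" "A' - A = A' * \<theta>" using A' by (simp_all add: \<theta>_def field_simps)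
  have comb: "(1 - \<theta>) *\<^sub>R v + \<theta> *\<^sub>R w \<in> D" if "v \<in> D" "w \<in> D" for v w
    using that \<theta> D(1) by (intro convexD) auto
  have xt: "xt \<in> D" using comb x y by (simp add: xt_def \<theta>)

  define p where "p = (\<lambda>u. \<Gamma>' u + N u + 1 / (2 * A') * (norm (u - x0))\<^sup>2)"
  have "\<exists>a d. \<forall>u. \<Gamma>' u = a \<bullet> u + d"
  proof (intro exI allI)
    fix u
    show "\<Gamma>' u = ((1 - \<theta>) *\<^sub>R a0 + \<theta> *\<^sub>R grad n psi_s xt) \<bullet> u
        + ((1 - \<theta>) * d0 + \<theta> * (psi_s xt - grad n psi_s xt \<bullet> xt))"
      by (simp add: \<Gamma>'_def \<Gamma>_affine \<theta> linearization_def algebra_simps)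
  qed
  then obtain a d where \<Gamma>'_affine: "\<And>u. \<Gamma>' u = a \<bullet> u + d" by blast
  have "\<exists>y\<in>D. \<forall>u\<in>D. p y \<le> p u"
    using prox_exists[of "1 / (2 * A')" a] A' by (simp add: p_def \<Gamma>'_affine add.assoc)
  then have "y' \<in> D \<and> (\<forall>u\<in>D. p y' \<le> p u)"
    unfolding y'_def using D(2) by (intro arg_min_on_ereal) (auto simp: psi_n p_def)
  then have y': "y' \<in> D" and y'_min: "\<And>u. u \<in> D \<Longrightarrow> p y' \<le> p u" by auto
  have "strongly_convex_on (2 * (1 / (2 * A')) + \<mu>) D
      (\<lambda>u. (a \<bullet> u + d + 1 / (2 * A') * (norm (u - x0))\<^sup>2) + N u)"
    by (intro strongly_convex_on_add strongly_convex_on_quadratic N_convex)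
  also have "(\<lambda>u. (a \<bullet> u + d + 1 / (2 * A') * (norm (u - x0))\<^sup>2) + N u) = p"
    by (simp add: p_def \<Gamma>'_affine fun_eq_iff)
  finally have p_sc: "strongly_convex_on (1 / A' + \<mu>) D p" by simp
  \<comment> \<open>multiplying the modulus \<open>1 / A' + \<mu>\<close> by \<open>A'\<close> restores the form \<open>\<mu> A' + 1\<close> of the invariant\<close>
  have growth': "A' * p y' + (\<mu> * A' + 1) / 2 * (norm (u - y'))\<^sup>2 \<le> A' * p u" if u: "u \<in> D" for u
  proof -
    have "A' * (p y' + (1 / A' + \<mu>) / 2 * (norm (u - y'))\<^sup>2) \<le> A' * p u"
      using strongly_convex_min_growth[OF D(1) p_sc y' y'_min u] A' by simp
    also have "A' * (p y' + (1 / A' + \<mu>) / 2 * (norm (u - y'))\<^sup>2)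
        = A' * p y' + (\<mu> * A' + 1) / 2 * (norm (u - y'))\<^sup>2"
      using A' by (simp add: field_simps)
    finally show ?thesis .
  qed
  have model': "model (acg_step n psi_s psi_n \<mu> L x0 s) u = A' * p u" for u
    using A' by (simp add: model_def step p_def field_simps)

  have x': "x' \<in> D" using comb x y' by (simp add: x'_def \<theta>)
  have lower': "A' * \<Gamma>' u \<le> A' * psi_s u" if u: "u \<in> D" for u
  proof -
    have "A' * \<Gamma>' u = A * \<Gamma> u + A' * \<theta> * linearization n psi_s u xt"
      using A' by (simp add: \<Gamma>'_def field_simps)
    also have "\<dots> \<le> A * psi_s u + A' * \<theta> * psi_s u"
      using psi_s_convex[OF xt u] A' \<theta> by (intro add_mono lower[OF u] mult_left_mono) auto
    also have "\<dots> = A' * psi_s u" by (subst A\<theta>(1)) (simp add: algebra_simps)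
    finally show ?thesis .
  qed

  have "A' * (psi_s x' + N x') \<le> A' * p y'"
  proof -
    let ?l = "\<lambda>u. linearization n psi_s u xt"
    have l_comb: "?l x' = (1 - \<theta>) * ?l x + \<theta> * ?l y'"
      unfolding linearization_def x'_def \<theta>(3)
      by (simp add: algebra_simps)
    have N_comb: "N x' \<le> (1 - \<theta>) * N x + \<theta> * N y'"
    \<comment> \<open>the first iteration has \<open>A = 0\<close>, hence \<open>\<theta> = 1\<close>, which strict convex combinations exclude\<close>
    proof (cases "\<theta> = 1")
      case False
      have "N x' \<le> (1 - \<theta>) * N x + \<theta> * N y' - \<mu> / 2 * \<theta> * (1 - \<theta>) * (norm (x - y'))\<^sup>2"
        unfolding x'_def \<theta>(3)
        by (rule N_convex[unfolded strongly_convex_on_def, rule_format]) (use x y' \<theta> False in auto)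
      moreover have "\<mu> / 2 * \<theta> * (1 - \<theta>) * (norm (x - y'))\<^sup>2 \<ge> 0"
        using \<mu> \<theta> by simp
      ultimately show ?thesis by linarith
    qed (unfold x'_def \<theta>(3), simp)
    have diff: "x' - xt = \<theta> *\<^sub>R (y' - y)" by (simp add: x'_def xt_def algebra_simps)
    have "A' * (L * \<theta>\<^sup>2) = \<tau>"
    proof -
      have "A' * (A' * (L * \<theta>\<^sup>2)) = A' * \<tau>"
        using sq unfolding A\<theta>(2) by (simp add: power2_eq_square algebra_simps)
      then show ?thesis using A' by simp
    qed
    then have quad: "A' * (L / 2 * (norm (x' - xt))\<^sup>2) = \<tau> / 2 * (norm (y' - y))\<^sup>2"
      unfolding diff by (simp add: power_mult_distrib)
    have "A' * (psi_s x' + N x') \<le> A' * (?l x' + L / 2 * (norm (x' - xt))\<^sup>2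
        + ((1 - \<theta>) * N x + \<theta> * N y'))"
      using psi_s_smooth[OF xt x'] N_comb A' by (intro mult_left_mono add_mono) auto
    also have "\<dots> = A * (?l x + N x) + \<tau> / 2 * (norm (y' - y))\<^sup>2 + A' * \<theta> * (?l y' + N y')"
      unfolding l_comb quad[symmetric] A\<theta>(1) by (simp add: algebra_simps)
    also have "A * (?l x + N x) \<le> A * (psi_s x + N x)"
      using psi_s_convex[OF xt x] A by (simp add: mult_left_mono)
    also have "A * (psi_s x + N x) \<le> model s y" by (rule est)
    also have "model s y + \<tau> / 2 * (norm (y' - y))\<^sup>2 + A' * \<theta> * (?l y' + N y')
        \<le> model s y' + A' * \<theta> * (?l y' + N y')"
      using growth[OF y'] by simp
    also have "\<dots> = A' * p y'"
    proof -
      have "A' * \<Gamma>' y' = A * \<Gamma> y' + A' * \<theta> * ?l y'"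
        using A' by (simp add: \<Gamma>'_def field_simps)
      moreover have "A' * N y' = A * N y' + A' * \<theta> * N y'"
        by (subst A\<theta>(1)) (simp add: algebra_simps)
      moreover have "A' * p y' = A' * \<Gamma>' y' + A' * N y' + 1 / 2 * (norm (y' - x0))\<^sup>2"
        using A' by (simp add: p_def field_simps)
      ultimately show ?thesis
        by (simp add: model_def A_def[symmetric] \<Gamma>_def[symmetric] algebra_simps)
    qed
    finally show ?thesis by simp
  qed
  with growth' lower' x' y' A' \<Gamma>'_affine show ?thesis
    unfolding estimate_def model' by (auto simp: step)
qed

lemma estimate_acg: "estimate (acg n psi_s psi_n \<mu> L x0 j)"
proof (induction j)
  case 0
  have "\<exists>a d. \<forall>u. 0 = a \<bullet> u + (d::real)" for a :: rseq
    by (intro exI[of _ 0]) simp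
  then show ?case using x0 by (auto simp: estimate_def acg_def model_def)
qed (simp add: acg_Suc estimate_step)

text \<open>
  What the rest of the argument needs to know about an ACG iterate. The growth of the model around
  its minimizer \<open>y\<close> says that \<open>u\<close> is a subgradient of \<open>\<Gamma> + psi_n\<close> at \<open>y\<close>, and moving the base point
  to \<open>x\<close> costs \<open>\<eta>\<close>; the residual inequality is the comparison of \<open>A\<close> times the objective with the
  minimal model value, rewritten with \<open>A u = x0 - y\<close>.
\<close>
lemma acg_triple_properties:
  assumes j: "j > 0" and triple: "acg_triple n psi_s psi_n \<mu> L x0 j = (x, u, \<eta>)"
  defines "A \<equiv> acg_A (acg n psi_s psi_n \<mu> L x0 j)"
  shows "x \<in> D" and "u \<in> Rn n" and "\<eta> \<ge> 0"
    and "(norm (A *\<^sub>R u + (x - x0)))\<^sup>2 + 2 * A * \<eta> \<le> (norm (x - x0))\<^sup>2"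
    and "w \<in> D \<Longrightarrow> psi_s x + N x + u \<bullet> (w - x) - \<eta> \<le> psi_s w + N w"
proof -
  define s where "s = acg n psi_s psi_n \<mu> L x0 j"
  define y where "y = acg_y s"
  define \<Gamma> where "\<Gamma> = acg_Gamma s"
  have A_s: "acg_A s = A" by (simp add: A_def s_def)
  have A: "A > 0" unfolding A_def using \<mu> L j by (rule acg_A_pos)
  have est: "estimate s" unfolding s_def by (rule estimate_acg)
  have x_eq: "acg_x s = x" and u_eq: "u = (1 / A) *\<^sub>R (x0 - y)"
    and \<eta>_eq: "\<eta> = real_of_ereal (ereal (psi_s x) + psi_n x - ereal (\<Gamma> y) - psi_n y
                             - ereal (u \<bullet> (x - y)))"
    using triple by (auto simp: acg_triple_def Let_def s_def y_def \<Gamma>_def A_def)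
  have y: "y \<in> D" using est by (simp add: estimate_def y_def)
  show x: "x \<in> D" using est x_eq by (simp add: estimate_def)
  show u: "u \<in> Rn n"
    unfolding u_eq using x0 y D(2) by (intro subspace_scale subspace_diff subspace_Rn) auto
  have \<eta>: "\<eta> = psi_s x + N x - \<Gamma> y - N y - u \<bullet> (x - y)"
    unfolding \<eta>_eq by (simp add: psi_n x y)
  have growth: "A * (\<Gamma> y + N y) + 1 / 2 * (norm (y - x0))\<^sup>2 + (\<mu> * A + 1) / 2 * (norm (w - y))\<^sup>2
      \<le> A * (\<Gamma> w + N w) + 1 / 2 * (norm (w - x0))\<^sup>2" if "w \<in> D" for w
    using est that by (simp add: estimate_def model_def A_s y_def \<Gamma>_def)
  have Au: "A *\<^sub>R u = x0 - y" using A by (simp add: u_eq)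
  \<comment> \<open>the distance to \<open>x0\<close> in the model is what makes \<open>u\<close> a subgradient at \<open>y\<close>\<close>
  have sub: "\<Gamma> y + N y + u \<bullet> (w - y) \<le> psi_s w + N w" if w: "w \<in> D" for w
  proof -
    have "(norm (w - x0))\<^sup>2 = (norm (y - x0))\<^sup>2 + (norm (w - y))\<^sup>2 - 2 * ((x0 - y) \<bullet> (w - y))"
      by (simp add: power2_norm_eq_inner inner_commute algebra_simps)
    also have "(x0 - y) \<bullet> (w - y) = A * (u \<bullet> (w - y))" by (simp add: Au[symmetric])
    finally have "A * (\<Gamma> y + N y) + \<mu> * A / 2 * (norm (w - y))\<^sup>2 + A * (u \<bullet> (w - y))
        \<le> A * (\<Gamma> w + N w)"
      using growth[OF w] by (simp add: algebra_simps add_divide_distrib)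
    moreover have "\<mu> * A / 2 * (norm (w - y))\<^sup>2 \<ge> 0" using \<mu> A by simp
    moreover have "A * \<Gamma> w \<le> A * psi_s w"
      using est w by (simp add: estimate_def A_s \<Gamma>_def)
    ultimately have "A * (\<Gamma> y + N y + u \<bullet> (w - y)) \<le> A * (psi_s w + N w)"
      by (simp add: algebra_simps)
    then show ?thesis using A by simp
  qed
  show sub': "psi_s x + N x + u \<bullet> (w - x) - \<eta> \<le> psi_s w + N w" if "w \<in> D" for w
    using sub[OF that] by (simp add: \<eta> inner_diff_right)
  show "\<eta> \<ge> 0" using sub'[OF x] by simp
  have "A * (psi_s x + N x) \<le> A * (\<Gamma> y + N y) + 1 / 2 * (norm (y - x0))\<^sup>2"
    using est by (simp add: estimate_def model_def A_s x_eq y_def \<Gamma>_def)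
  then have "2 * A * \<eta> \<le> (norm (y - x0))\<^sup>2 - 2 * ((A *\<^sub>R u) \<bullet> (x - y))"
    by (simp add: \<eta> algebra_simps)
  also have "\<dots> = (norm (x - x0))\<^sup>2 - (norm (x - y))\<^sup>2"
    unfolding Au by (simp add: power2_norm_eq_inner inner_commute algebra_simps)
  also have "x - y = A *\<^sub>R u + (x - x0)" by (simp add: Au)
  finally show "(norm (A *\<^sub>R u + (x - x0)))\<^sup>2 + 2 * A * \<eta> \<le> (norm (x - x0))\<^sup>2" by simp
qed

end

section \<open>Consequences of the residual inequality\<close>

text \<open>
  Consequences of the residual inequality, to be read with \<open>d = x - x0\<close>: both \<open>u\<close> and \<open>\<eta>\<close> are small
  relative to \<open>d\<close> once \<open>A\<close> is large, so the residual \<open>x0 - x + u = u - d\<close> has nearly the norm of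
  \<open>d\<close>. The threshold \<open>18\<close> is what \<open>6 sqrt (2 l M + 1)\<close> iterations guarantee.
\<close>
lemma acg_residual_bounds:
  fixes u d :: "'a::real_inner"
  assumes A: "A \<ge> 18" and \<eta>: "\<eta> \<ge> 0"
    and le: "(norm (A *\<^sub>R u + d))\<^sup>2 + 2 * A * \<eta> \<le> (norm d)\<^sup>2"
  shows "norm u \<le> 2 / A * norm d"
    and "2 * A * \<eta> \<le> (norm d)\<^sup>2"
    and "8 / 9 * norm d \<le> norm (u - d)"
    and "norm (u - d) \<le> 10 / 9 * norm d"
proof -
  have \<eta>': "2 * A * \<eta> \<ge> 0" using A \<eta> by simp
  show "2 * A * \<eta> \<le> (norm d)\<^sup>2"
    using le zero_le_power2[of "norm (A *\<^sub>R u + d)"] by linarith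
  have "(norm (A *\<^sub>R u + d))\<^sup>2 \<le> (norm d)\<^sup>2" using le \<eta>' by linarith
  then have "norm (A *\<^sub>R u + d) \<le> norm d" by simp
  then have "norm (A *\<^sub>R u) \<le> 2 * norm d"
    using norm_triangle_ineq4[of "A *\<^sub>R u + d" d] by simp
  then show u: "norm u \<le> 2 / A * norm d" using A by (simp add: field_simps)
  have "2 / A * norm d \<le> 1 / 9 * norm d" using A by (intro mult_right_mono) (auto simp: field_simps)
  with u have "norm u \<le> 1 / 9 * norm d" by linarith
  then show "8 / 9 * norm d \<le> norm (u - d)" "norm (u - d) \<le> 10 / 9 * norm d"
    using norm_triangle_ineq2[of d u] norm_triangle_ineq4[of u d] by (simp_all add: norm_minus_commute)
qed

lemma acg_residual_accepted:
  fixes u d :: "'a::real_inner"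
  assumes \<sigma>: "0 < \<sigma>" "\<sigma> < 1" and A: "A \<ge> 18 / \<sigma>" and \<eta>: "\<eta> \<ge> 0"
    and le: "(norm (A *\<^sub>R u + d))\<^sup>2 + 2 * A * \<eta> \<le> (norm d)\<^sup>2"
  shows "(norm u)\<^sup>2 + 2 * \<eta> \<le> \<sigma> * (norm (u - d))\<^sup>2"
proof -
  have A\<sigma>: "18 \<le> A * \<sigma>" using A \<sigma> by (simp add: field_simps)
  have "18 \<le> 18 / \<sigma>" using \<sigma> by (simp add: field_simps)
  with A have A18: "A \<ge> 18" by linarith
  note bounds = acg_residual_bounds[OF A18 \<eta> le]
  have "A * (A * (norm u)\<^sup>2) = (A * norm u)\<^sup>2" by (simp add: power2_eq_square)
  also have "\<dots> \<le> (2 * norm d)\<^sup>2"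
    using bounds(1) A18 by (intro power_mono) (auto simp: field_simps)
  finally have "A * (A * (norm u)\<^sup>2) \<le> 4 * (norm d)\<^sup>2" by (simp add: power_mult_distrib)
  moreover have "18 * (A * (norm u)\<^sup>2) \<le> A * (A * (norm u)\<^sup>2)"
    using A18 by (intro mult_right_mono) auto
  ultimately have "A * ((norm u)\<^sup>2 + 2 * \<eta>) \<le> 11 / 9 * (norm d)\<^sup>2"
    using bounds(2) by (simp add: algebra_simps)
  also have "\<dots> \<le> 18 * (8 / 9 * norm d)\<^sup>2" by (simp add: power_mult_distrib power2_eq_square)
  also have "\<dots> \<le> (A * \<sigma>) * (norm (u - d))\<^sup>2"
    using A\<sigma> bounds(3) by (intro mult_mono power_mono) auto
  finally have "A * ((norm u)\<^sup>2 + 2 * \<eta>) \<le> A * (\<sigma> * (norm (u - d))\<^sup>2)" by simp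
  then show ?thesis using A18 by simp
qed

text \<open>
  Here \<open>e\<close> is the vector from the exact minimizer to the iterate. The residual inequality bounds
  \<open>\<eta>\<close> by \<open>|u| |d| - 9 |u|^2\<close>; keeping the negative term and maximizing over \<open>|u|\<close> gives the constant
  \<open>1/2\<close>, which the refinement step at the end depends on.
\<close>
lemma acg_residual_distance:
  fixes u d e :: "'a::real_inner"
  assumes A: "A \<ge> 18" and le: "(norm (A *\<^sub>R u + d))\<^sup>2 + 2 * A * \<eta> \<le> (norm d)\<^sup>2"
    and e: "1 / 4 * (norm e)\<^sup>2 \<le> u \<bullet> e + \<eta>"
  shows "2 * norm e \<le> norm d"
proof -
  have "(norm (A *\<^sub>R u + d))\<^sup>2 = A * (A * (norm u)\<^sup>2) + A * (2 * (u \<bullet> d)) + (norm d)\<^sup>2"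
    by (simp add: power2_norm_eq_inner inner_commute algebra_simps)
  then have "A * (A * (norm u)\<^sup>2 + 2 * (u \<bullet> d) + 2 * \<eta>) \<le> 0" using le by (simp add: algebra_simps)
  then have "A * (norm u)\<^sup>2 + 2 * (u \<bullet> d) + 2 * \<eta> \<le> 0" using A by (simp add: mult_le_0_iff)
  moreover have "18 * (norm u)\<^sup>2 \<le> A * (norm u)\<^sup>2" using A by (intro mult_right_mono) auto
  moreover have "- (u \<bullet> d) \<le> norm u * norm d" using Cauchy_Schwarz_ineq2[of u d] by linarith
  ultimately have "\<eta> \<le> norm u * norm d - 9 * (norm u)\<^sup>2" by linarith
  with e have "1 / 4 * (norm e)\<^sup>2 \<le> norm u * norm e + norm u * norm d - 9 * (norm u)\<^sup>2"
    using norm_cauchy_schwarz[of u e] by linarith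
  also have "\<dots> \<le> (norm e + norm d)\<^sup>2 / 36"
  proof -
    have "(3 * norm u - (norm e + norm d) / 6)\<^sup>2
        = 9 * (norm u)\<^sup>2 - norm u * (norm e + norm d) + (norm e + norm d)\<^sup>2 / 36"
      by (simp add: power2_diff power_mult_distrib power_divide)
    with zero_le_power2[of "3 * norm u - (norm e + norm d) / 6"]
      distrib_left[of "norm u" "norm e" "norm d"] show ?thesis
      by linarith
  qed
  finally have "(3 * norm e)\<^sup>2 \<le> (norm e + norm d)\<^sup>2" by (simp add: power_mult_distrib)
  then have "3 * norm e \<le> norm e + norm d" by (rule power2_le_imp_le) simp
  then show ?thesis by simp
qed

section \<open>The proximal subproblems\<close>

text \<open>
  The condition \<open>l m \<le> 1/2\<close> makes \<open>l g + 1/4 |. - c|^2\<close> convex, although \<open>g\<close> itself need not be.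
\<close>
locale composite_problem =
  fixes n :: nat and g :: "rseq \<Rightarrow> real" and h :: "rseq \<Rightarrow> ereal" and m M l :: real
  assumes A1: "A1 n h" and A2: "A2 n g h m M" and l: "l > 0" "l * m \<le> 1 / 2"
begin

abbreviation D :: "rseq set" where "D \<equiv> eff_dom n h"

definition \<phi> :: "rseq \<Rightarrow> real"
  where "\<phi> u = g u + fin_part h u"

definition prox_obj :: "rseq \<Rightarrow> rseq \<Rightarrow> real"
  where "prox_obj c u = l * \<phi> u + 1 / 2 * (norm (u - c))\<^sup>2"

lemma mM: "0 < m" "m \<le> M"
  using A2 by (auto simp: A2_def)

lemma phi_eq: "u \<in> D \<Longrightarrow> phi g h u = ereal (\<phi> u)"
  by (simp add: phi_def \<phi>_def ereal_fin_part[OF A1])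

lemma phi_outside: "u \<in> Rn n \<Longrightarrow> u \<notin> D \<Longrightarrow> phi g h u = \<infinity>"
  by (simp add: phi_def outside_eff_dom)

lemma D_Rn: "u \<in> D \<Longrightarrow> u \<in> Rn n"
  using eff_dom_subset by blast

lemma g_differentiable: "z \<in> D \<Longrightarrow> g differentiable (at z within Rn n)"
  using A2 by (auto simp: A2_def)

lemma
  assumes "z \<in> D" "u \<in> D"
  shows g_lower: "linearization n g u z - m / 2 * (norm (u - z))\<^sup>2 \<le> g u"
    and g_upper: "g u \<le> linearization n g u z + M / 2 * (norm (u - z))\<^sup>2"
proof -
  have "- (m / 2) * (norm (u - z))\<^sup>2 \<le> g u - linearization n g u z \<and>
      g u - linearization n g u z \<le> M / 2 * (norm (u - z))\<^sup>2"
    using A2 assms unfolding A2_def by blast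
  then show "linearization n g u z - m / 2 * (norm (u - z))\<^sup>2 \<le> g u"
    "g u \<le> linearization n g u z + M / 2 * (norm (u - z))\<^sup>2"
    by linarith+
qed

lemma g_lower_scaled:
  assumes "z \<in> D" "u \<in> D"
  shows "l * linearization n g u z - 1 / 4 * (norm (u - z))\<^sup>2 \<le> l * g u"
proof -
  have "l * (linearization n g u z - m / 2 * (norm (u - z))\<^sup>2) \<le> l * g u"
    using g_lower[OF assms] l by simp
  moreover have "(l * m) * (norm (u - z))\<^sup>2 \<le> 1 / 2 * (norm (u - z))\<^sup>2"
    using l by (intro mult_right_mono) auto
  ultimately show ?thesis by (simp add: algebra_simps)
qed

text \<open>
  The proximal term is split evenly: one quarter convexifies \<open>l g\<close>, the other makes the nonsmooth
  part \<open>1/2\<close>-strongly convex.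
\<close>
lemma acg_problem_prox:
  assumes c: "c \<in> D"
  shows "acg_problem n (\<lambda>w. l * g w + 1 / 4 * (norm (w - c))\<^sup>2)
    (\<lambda>w. l * fin_part h w + 1 / 4 * (norm (w - c))\<^sup>2)
    (\<lambda>w. ereal l * h w + ereal (1 / 4 * (norm (w - c))\<^sup>2)) (1 / 2) (l * M + 1 / 2) c D"
proof
  let ?s = "\<lambda>w. l * g w + 1 / 4 * (norm (w - c))\<^sup>2"
  show "convex D" by (rule convex_eff_dom[OF A1])
  show "D \<subseteq> Rn n" by (rule eff_dom_subset)
  show "c \<in> D" by (rule c)
  show "(0::real) \<le> 1 / 2" by simp
  show "0 < l * M + 1 / 2" using mM l by (simp add: add_pos_pos)
  show "ereal l * h u + ereal (1 / 4 * (norm (u - c))\<^sup>2)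
      = ereal (l * fin_part h u + 1 / 4 * (norm (u - c))\<^sup>2)" if "u \<in> D" for u
    using that by (simp add: ereal_fin_part[OF A1])
  show "ereal l * h u + ereal (1 / 4 * (norm (u - c))\<^sup>2) = \<infinity>" if "u \<in> Rn n" "u \<notin> D" for u
    using outside_eff_dom[OF that] l by simp
  show "strongly_convex_on (1 / 2) D (\<lambda>w. l * fin_part h w + 1 / 4 * (norm (w - c))\<^sup>2)"
    using strongly_convex_on_add[OF strongly_convex_on_scale[OF convex_fin_part[OF A1], of l]
        strongly_convex_on_quadratic[of "1 / 4" D 0 0 c]] l by simp
  have s_eq: "?s u - linearization n ?s u z
      = l * (g u - linearization n g u z) + 1 / 4 * (norm (u - z))\<^sup>2" if z: "z \<in> D" for z u
    unfolding linearization_def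
    by (subst grad_regularized[OF D_Rn[OF z] D_Rn[OF c] g_differentiable[OF z]])
      (simp add: norm_sq_shift[of u c z] algebra_simps)
  show "linearization n ?s u z \<le> ?s u" if "z \<in> D" "u \<in> D" for z u
    using s_eq[OF that(1), of u] g_lower_scaled[OF that] by (simp add: algebra_simps)
  show "?s u \<le> linearization n ?s u z + (l * M + 1 / 2) / 2 * (norm (u - z))\<^sup>2"
    if "z \<in> D" "u \<in> D" for z u
  proof -
    have "l * g u \<le> l * (linearization n g u z + M / 2 * (norm (u - z))\<^sup>2)"
      using g_upper[OF that] l by simp
    then show ?thesis using s_eq[OF that(1), of u] by (simp add: algebra_simps add_divide_distrib)
  qed
  show "\<exists>y\<in>D. \<forall>u\<in>D. a \<bullet> y + (l * fin_part h y + 1 / 4 * (norm (y - c))\<^sup>2) + b * (norm (y - c))\<^sup>2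
      \<le> a \<bullet> u + (l * fin_part h u + 1 / 4 * (norm (u - c))\<^sup>2) + b * (norm (u - c))\<^sup>2"
    if b: "b > 0" for a b
    using regularized_min_quadratic(2)[OF A1 l(1), of "1 / 4 + b" a 0 c] b
    by (simp add: algebra_simps)
qed

lemma prox_obj_minimizer:
  assumes c: "c \<in> D"
  obtains xs where "xs \<in> D"
    "\<And>u. u \<in> D \<Longrightarrow> prox_obj c xs + 1 / 4 * (norm (u - xs))\<^sup>2 \<le> prox_obj c u"
proof -
  let ?q = "\<lambda>u. l * g u + 1 / 2 * (norm (u - c))\<^sup>2"
  have support: "\<exists>a. \<forall>u\<in>D. ?q u \<ge> ?q z + a \<bullet> (u - z) + (1 / 2) / 2 * (norm (u - z))\<^sup>2"
    if z: "z \<in> D" for z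
  proof (intro exI ballI)
    fix u assume u: "u \<in> D"
    show "?q u \<ge> ?q z + (l *\<^sub>R grad n g z + (z - c)) \<bullet> (u - z) + (1 / 2) / 2 * (norm (u - z))\<^sup>2"
      using g_lower_scaled[OF z u]
      by (simp add: norm_sq_shift[of u c z] linearization_def algebra_simps)
  qed
  have cont: "continuous (at z within Rn n) ?q" if "z \<in> D" for z
    using g_differentiable[OF that]
    by (intro continuous_intros differentiable_imp_continuous_within)
  have obj: "prox_obj c = (\<lambda>u. l * fin_part h u + ?q u)"
    by (simp add: prox_obj_def \<phi>_def fun_eq_iff algebra_simps)
  have sc: "strongly_convex_on (1 / 2) D (prox_obj c)"
    unfolding obj by (rule regularized_min(1)[OF A1 l(1) _ support cont]) auto
  have "\<exists>y\<in>D. \<forall>u\<in>D. prox_obj c y \<le> prox_obj c u"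
    unfolding obj by (rule regularized_min(2)[OF A1 l(1) _ support cont]) auto
  then obtain xs where xs: "xs \<in> D" "\<And>u. u \<in> D \<Longrightarrow> prox_obj c xs \<le> prox_obj c u" by blast
  then show ?thesis
    using strongly_convex_min_growth[OF convex_eff_dom[OF A1] sc xs] that[of xs] by simp
qed

text \<open>
  The accumulated step sizes \<open>A\<close> of the ACG run with prox-center \<open>c\<close>.
\<close>
definition weight :: "rseq \<Rightarrow> nat \<Rightarrow> real"
  where "weight c j = acg_A (acg n (\<lambda>w. l * g w + 1 / 4 * (norm (w - c))\<^sup>2)
    (\<lambda>w. ereal l * h w + ereal (1 / 4 * (norm (w - c))\<^sup>2)) (1 / 2) (l * M + 1 / 2) c j)"

lemma aipp_triple_properties:
  assumes c: "c \<in> D" and j: "j > 0" and triple: "aipp_triple n g h M l c j = (x, u, \<eta>)"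
  shows "x \<in> D" and "u \<in> Rn n" and "\<eta> \<ge> 0"
    and "(norm (weight c j *\<^sub>R u + (x - c)))\<^sup>2 + 2 * weight c j * \<eta> \<le> (norm (x - c))\<^sup>2"
    and "w \<in> D \<Longrightarrow> prox_obj c x + u \<bullet> (w - x) - \<eta> \<le> prox_obj c w"
proof -
  interpret acg_problem n "\<lambda>w. l * g w + 1 / 4 * (norm (w - c))\<^sup>2"
    "\<lambda>w. l * fin_part h w + 1 / 4 * (norm (w - c))\<^sup>2"
    "\<lambda>w. ereal l * h w + ereal (1 / 4 * (norm (w - c))\<^sup>2)" "1 / 2" "l * M + 1 / 2" c D
    by (rule acg_problem_prox[OF c])
  have obj: "l * g w + 1 / 4 * (norm (w - c))\<^sup>2 + (l * fin_part h w + 1 / 4 * (norm (w - c))\<^sup>2) = prox_obj c w" for w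
    by (simp add: prox_obj_def \<phi>_def algebra_simps)
  note props = acg_triple_properties[OF j triple[unfolded aipp_triple_def]]
  show "x \<in> D" "u \<in> Rn n" "\<eta> \<ge> 0"
    "(norm (weight c j *\<^sub>R u + (x - c)))\<^sup>2 + 2 * weight c j * \<eta> \<le> (norm (x - c))\<^sup>2"
    using props(1-4) by (simp_all add: weight_def)
  show "prox_obj c x + u \<bullet> (w - x) - \<eta> \<le> prox_obj c w" if "w \<in> D"
    using props(5)[OF that] unfolding obj .
qed

lemma prox_subdifferential_iff:
  "v \<in> eps_subdifferential n e (\<lambda>w. ereal l * phi g h w + ereal (1 / 2 * (norm (w - c))\<^sup>2)) x \<longleftrightarrow>
    v \<in> Rn n \<and> x \<in> D \<and> (\<forall>w\<in>D. prox_obj c x + v \<bullet> (w - x) - e \<le> prox_obj c w)"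
  by (rule eps_subdifferential_iff[OF eff_dom_subset])
    (use l in \<open>auto simp: phi_eq phi_outside prox_obj_def\<close>)

lemma aipp_accepts_iff:
  assumes "c \<in> D" "j > 0" "aipp_triple n g h M l c j = (x, u, \<eta>)"
  shows "aipp_accepts n g h l \<sigma> c (x, u, \<eta>) \<longleftrightarrow> (norm u)\<^sup>2 + 2 * \<eta> \<le> \<sigma> * (norm (c - x + u))\<^sup>2"
  unfolding aipp_accepts_def prod.case prox_subdifferential_iff
  using aipp_triple_properties[OF assms] by blast

lemma aipp_iterate_accepted:
  assumes c: "c \<in> D" and j: "j > 0" and \<sigma>: "0 < \<sigma>" "\<sigma> < 1" and A: "weight c j \<ge> 18 / \<sigma>"
  shows "aipp_accepts n g h l \<sigma> c (aipp_triple n g h M l c j)"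
proof -
  obtain x u \<eta> where t: "aipp_triple n g h M l c j = (x, u, \<eta>)" by (metis prod_cases3)
  note props = aipp_triple_properties[OF c j t]
  have "u - (x - c) = c - x + u" by simp
  with acg_residual_accepted[OF \<sigma> A props(3,4)] show ?thesis
    by (simp add: t aipp_accepts_iff[OF c j t])
qed

text \<open>x\<close>
text \<open>
  Two iterates of the same run have comparable residuals, because both lie within half of their
  distance to \<open>c\<close> from the exact proximal point. Hence the small residual at the end of Step 1
  controls every iterate that Step 3 may return, and bounds its \<open>\<eta>\<close> by the inverse of the weight.
\<close>
lemma aipp_residual_stable:
  assumes c: "c \<in> D"
    and j: "j > 0" "weight c j \<ge> 18" and t: "aipp_triple n g h M l c j = (x, u, \<eta>)"
    and j': "j' > 0" "weight c j' \<ge> 18" and t': "aipp_triple n g h M l c j' = (x', u', \<eta>')"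
  shows "norm (c - x' + u') \<le> 15 / 4 * norm (c - x + u)"
    and "weight c j' * \<eta>' \<le> 6 * (norm (c - x + u))\<^sup>2"
proof -
  obtain xs where xs: "xs \<in> D"
    and growth: "\<And>w. w \<in> D \<Longrightarrow> prox_obj c xs + 1 / 4 * (norm (w - xs))\<^sup>2 \<le> prox_obj c w"
    using prox_obj_minimizer[OF c] by blast
  have close: "2 * norm (x - xs) \<le> norm (x - c)"
    if "j > 0" "weight c j \<ge> 18" "aipp_triple n g h M l c j = (x, u, \<eta>)" for j x u \<eta>
  proof -
    note props = aipp_triple_properties[OF c that(1,3)]
    have "1 / 4 * (norm (x - xs))\<^sup>2 \<le> u \<bullet> (x - xs) + \<eta>"
      using growth[OF props(1)] props(5)[OF xs] by (simp add: inner_diff_right)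
    from acg_residual_distance[OF that(2) props(4) this] show ?thesis .
  qed
  note props = aipp_triple_properties[OF c j(1) t] and props' = aipp_triple_properties[OF c j'(1) t']
  note bounds = acg_residual_bounds[OF j(2) props(3,4)]
    and bounds' = acg_residual_bounds[OF j'(2) props'(3,4)]
  have "norm (x' - c) \<le> 3 * norm (x - c)"
    using close[OF j t] close[OF j' t'] norm_triangle_ineq[of "x' - xs" "xs - c"]
      norm_triangle_ineq[of "xs - x" "x - c"] by (simp add: norm_minus_commute)
  moreover have r: "u - (x - c) = c - x + u" "u' - (x' - c) = c - x' + u'" by simp_all
  ultimately show "norm (c - x' + u') \<le> 15 / 4 * norm (c - x + u)"
    using bounds(3) bounds'(4) unfolding r by linarith
  have "norm (x' - c) \<le> 27 / 8 * norm (c - x + u)"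
    using \<open>norm (x' - c) \<le> 3 * norm (x - c)\<close> bounds(3) unfolding r by linarith
  then have "(norm (x' - c))\<^sup>2 \<le> (27 / 8 * norm (c - x + u))\<^sup>2" by (intro power_mono) auto
  also have "\<dots> = 729 / 64 * (norm (c - x + u))\<^sup>2" by (simp add: power_mult_distrib power2_eq_square)
  also have "\<dots> \<le> 12 * (norm (c - x + u))\<^sup>2" by simp
  finally show "weight c j' * \<eta>' \<le> 6 * (norm (c - x + u))\<^sup>2"
    using bounds'(2) by simp
qed

end

section \<open>Inner iterations per subproblem\<close>

lemma is_first_exists:
  assumes "P k"
  obtains j where "is_first P j" "j \<le> k"
proof (rule that)
  show "is_first P (LEAST j. P j)"
    using assms not_less_Least by (auto simp: is_first_def intro: LeastI)
  show "(LEAST j. P j) \<le> k" by (rule Least_le) (rule assms)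
qed

lemma is_first_le: "is_first P j \<Longrightarrow> P k \<Longrightarrow> j \<le> k"
  by (meson is_first_def not_less)

text \<open>
  Turns geometric growth with ratio \<open>1 + s\<close> into a number of steps proportional to \<open>1 / s\<close>.
\<close>
lemma half_le_ln_one_plus:
  fixes s :: real
  assumes "0 \<le> s" "s \<le> 1"
  shows "s / 2 \<le> ln (1 + s)"
proof -
  have "ln (1 / (1 + s)) \<le> 1 / (1 + s) - 1" using assms by (intro ln_le_minus_one) simp
  moreover have "ln (1 / (1 + s)) = - ln (1 + s)" using assms by (simp add: ln_div)
  moreover have "1 / (1 + s) - 1 = - (s / (1 + s))" using assms by (simp add: field_simps)
  moreover have "s / 2 \<le> s / (1 + s)" using assms by (intro divide_left_mono) auto
  ultimately show ?thesis by linarith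
qed

text \<open>
  The first summand pays for the outer iterations that reduce the objective, the second for the
  first and the last run of Step 1, and \<open>7\<close> for the additional iterations of Step 3.
\<close>
definition aipp_constant :: "real \<Rightarrow> real"
  where "aipp_constant \<sigma> = 10 * (6400 / (1 - \<sigma>)\<^sup>2) / \<sigma> + 20 / \<sigma> + 7"

locale aipp_run = composite_problem n g h m M l
  for n :: nat and g :: "rseq \<Rightarrow> real" and h :: "rseq \<Rightarrow> ereal" and m M l :: real +
  fixes \<rho>_hat \<sigma> \<rho> \<epsilon> :: real and z0 :: rseq
  assumes A3: "A3 n g h" and z0: "z0 \<in> eff_dom n h" and \<sigma>: "0 < \<sigma>" "\<sigma> < 1" and \<rho>_hat: "\<rho>_hat > 0"
    and l_eq: "l = 1 / (2 * m)" and \<rho>_eq: "\<rho> = \<rho>_hat / 4"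
    and \<epsilon>_eq: "\<epsilon> = \<rho>_hat\<^sup>2 / (32 * (M + 2 * m))"
begin

text \<open>
  \<open>\<kappa>\<close> is the condition number; with \<open>l = 1 / (2 m)\<close> the smoothness constant \<open>l M + 1/2\<close> of the
  subproblems lies between \<open>1\<close> and \<open>\<kappa>\<close>. A run of Step 1 takes at most \<open>step1_cap\<close> iterations, Step 3
  ends at iteration \<open>step1_cap + step3_cap\<close> at the latest, and \<open>outer_gain\<close> is the decrease of
  \<open>l \<phi>\<close> in an outer iteration that does not stop.
\<close>
definition \<kappa> :: real where "\<kappa> = M / m"
definition step1_cap :: nat where "step1_cap = nat \<lceil>9 * sqrt \<kappa> / \<sigma>\<rceil>"
definition step3_cap :: nat where "step3_cap = nat \<lceil>6 * sqrt \<kappa> * ln \<kappa>\<rceil>"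
definition outer_gain :: real where "outer_gain = (1 - \<sigma>) / 2 * (l * \<rho> / 5)\<^sup>2"

lemma \<kappa>: "\<kappa> \<ge> 1" using mM by (simp add: \<kappa>_def)

lemma sqrt_\<kappa>: "sqrt \<kappa> \<ge> 1" using \<kappa> by simp

lemma L_bounds: "1 \<le> l * M + 1 / 2" "l * M + 1 / 2 \<le> \<kappa>" and lM: "2 * l * M + 1 = \<kappa> + 1"
proof -
  have "l * M = \<kappa> / 2" using mM by (simp add: l_eq \<kappa>_def)
  then show "1 \<le> l * M + 1 / 2" "l * M + 1 / 2 \<le> \<kappa>" "2 * l * M + 1 = \<kappa> + 1" using \<kappa> by simp_all
qed

lemma l\<rho>: "l * \<rho> > 0"
  using l \<rho>_hat by (simp add: \<rho>_eq)

lemma step1_cap_lower: "9 * sqrt \<kappa> / \<sigma> \<le> real step1_cap" and step1_cap_upper: "real step1_cap \<le> 10 * sqrt \<kappa> / \<sigma>" and step1_cap_pos: "step1_cap > 0"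
proof -
  have "\<sigma> \<le> sqrt \<kappa>" using sqrt_\<kappa> \<sigma> by linarith
  then have ge: "1 \<le> sqrt \<kappa> / \<sigma>" using \<sigma> by simp
  show "9 * sqrt \<kappa> / \<sigma> \<le> real step1_cap" unfolding step1_cap_def by (rule real_nat_ceiling_ge)
  then show "step1_cap > 0" using ge by (cases step1_cap) auto
  have "real step1_cap = real_of_int \<lceil>9 * sqrt \<kappa> / \<sigma>\<rceil>" using \<kappa> \<sigma> by (simp add: step1_cap_def)
  also have "\<dots> \<le> 9 * sqrt \<kappa> / \<sigma> + 1" by linarith
  also have "\<dots> \<le> 10 * sqrt \<kappa> / \<sigma>" using ge by simp
  finally show "real step1_cap \<le> 10 * sqrt \<kappa> / \<sigma>" .
qed

lemma step3_cap_lower: "6 * sqrt \<kappa> * ln \<kappa> \<le> real step3_cap" and step3_cap_upper: "real step3_cap \<le> 7 * sqrt \<kappa> * log1_plus \<kappa>"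
proof -
  show "6 * sqrt \<kappa> * ln \<kappa> \<le> real step3_cap" unfolding step3_cap_def by (rule real_nat_ceiling_ge)
  have "real step3_cap = real_of_int \<lceil>6 * sqrt \<kappa> * ln \<kappa>\<rceil>" using \<kappa> by (simp add: step3_cap_def)
  also have "\<dots> \<le> 6 * sqrt \<kappa> * ln \<kappa> + 1" by linarith
  also have "\<dots> \<le> 6 * sqrt \<kappa> * log1_plus \<kappa> + sqrt \<kappa> * log1_plus \<kappa>"
  proof (rule add_mono)
    show "6 * sqrt \<kappa> * ln \<kappa> \<le> 6 * sqrt \<kappa> * log1_plus \<kappa>"
      using \<kappa> by (intro mult_left_mono) (auto simp: log1_plus_def)
    have "1 * 1 \<le> sqrt \<kappa> * log1_plus \<kappa>"
      using sqrt_\<kappa> by (intro mult_mono) (auto simp: log1_plus_def)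
    then show "1 \<le> sqrt \<kappa> * log1_plus \<kappa>" by simp
  qed
  finally show "real step3_cap \<le> 7 * sqrt \<kappa> * log1_plus \<kappa>" by (simp add: algebra_simps)
qed

lemma weight_quadratic: "(real j)\<^sup>2 / (4 * (l * M + 1 / 2)) \<le> weight c j"
  unfolding weight_def using L_bounds by (intro acg_A_quadratic_growth) auto

lemma weight_after_step1_cap:
  assumes "j \<ge> step1_cap"
  shows "weight c j \<ge> 18 / \<sigma>"
proof -
  \<comment> \<open>the factor \<open>9\<close> in the cap comes from \<open>81 / 4 \<ge> 18\<close>\<close>
  have "18 / \<sigma> \<le> 81 / (4 * \<sigma>\<^sup>2)"
    using \<sigma> by (simp add: field_simps power2_eq_square)
  also have "\<dots> = (9 * sqrt \<kappa> / \<sigma>)\<^sup>2 / (4 * \<kappa>)"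
    using \<kappa> by (simp add: power_divide power_mult_distrib)
  also have "\<dots> \<le> (real j)\<^sup>2 / (4 * (l * M + 1 / 2))"
    using step1_cap_lower assms \<kappa> \<sigma> L_bounds by (intro frac_le power_mono) auto
  also have "\<dots> \<le> weight c j" by (rule weight_quadratic)
  finally show ?thesis .
qed

lemma weight_min_iterations:
  assumes "int j \<ge> \<lceil>6 * sqrt (2 * l * M + 1)\<rceil>"
  shows "j > 0" and "weight c j \<ge> 18"
proof -
  have le: "6 * sqrt (\<kappa> + 1) \<le> real j" using assms unfolding lM by linarith
  have "0 < 6 * sqrt (\<kappa> + 1)" using \<kappa> by simp
  then show "j > 0" using le by (cases j) auto
  have L: "4 * (l * M + 1 / 2) = 2 * (\<kappa> + 1)" using lM by (simp add: algebra_simps)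
  have "18 = (6 * sqrt (\<kappa> + 1))\<^sup>2 / (2 * (\<kappa> + 1))"
    using \<kappa> by (simp add: power_mult_distrib field_simps)
  also have "\<dots> \<le> (real j)\<^sup>2 / (4 * (l * M + 1 / 2))"
    unfolding L using le \<kappa> by (intro divide_right_mono power_mono) auto
  also have "\<dots> \<le> weight c j" by (rule weight_quadratic)
  finally show "weight c j \<ge> 18" .
qed

lemma step1_cap_min_iterations: "int step1_cap \<ge> \<lceil>6 * sqrt (2 * l * M + 1)\<rceil>"
proof -
  \<comment> \<open>the prescribed minimum fits under the cap since \<open>36 (\<kappa> + 1) \<le> 72 \<kappa> \<le> 81 \<kappa>\<close>\<close>
  have "6 * sqrt (\<kappa> + 1) = sqrt (36 * (\<kappa> + 1))" using real_sqrt_mult[of 36 "\<kappa> + 1"] by simp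
  also have "\<dots> \<le> sqrt (81 * \<kappa>)" using \<kappa> by simp
  also have "\<dots> = 9 * sqrt \<kappa>" by (simp add: real_sqrt_mult)
  also have "\<dots> \<le> 9 * sqrt \<kappa> / \<sigma>" using \<kappa> \<sigma> by (simp add: field_simps)
  also have "\<dots> \<le> real step1_cap" by (rule step1_cap_lower)
  finally show ?thesis unfolding lM by (simp add: ceiling_le_iff)
qed

text \<open>
  Quadratic growth alone would need on the order of \<open>\<kappa>\<close> iterations to reach weight \<open>\<kappa>\<close>; the geometric growth with
  ratio \<open>1 + sqrt (1 / (2 L))\<close>, where \<open>L \<le> \<kappa>\<close>, needs only \<open>O (sqrt \<kappa> ln \<kappa>)\<close>. This is where the
  logarithm in the complexity bound comes from.
\<close>
lemma weight_at_both_caps: "\<kappa> \<le> weight c (step1_cap + step3_cap)"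
proof -
  define L where "L = l * M + 1 / 2"
  define s where "s = sqrt (1 / 2 / L)"
  define k where "k = step1_cap + step3_cap - 1"
  have L: "1 \<le> L" "L \<le> \<kappa>" using L_bounds by (simp_all add: L_def)
  have k: "step1_cap + step3_cap = Suc k" "6 * sqrt \<kappa> * ln \<kappa> \<le> real k"
    using step1_cap_pos step3_cap_lower by (auto simp: k_def)
  have s: "0 \<le> s" "s \<le> 1" using L by (auto simp: s_def field_simps)
  have "1 / (3 / 2 * sqrt \<kappa>) \<le> s"
  proof -
    have "sqrt (2 * L) \<le> sqrt (9 / 4 * \<kappa>)" using L by simp
    also have "\<dots> = 3 / 2 * sqrt \<kappa>" by (simp add: real_sqrt_mult real_sqrt_divide)
    finally have "1 / (3 / 2 * sqrt \<kappa>) \<le> 1 / sqrt (2 * L)"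
      using L by (intro divide_left_mono) auto
    also have "\<dots> = s" by (simp add: s_def real_sqrt_divide real_sqrt_mult)
    finally show ?thesis .
  qed
  then have "(6 * sqrt \<kappa> * ln \<kappa>) * (1 / (3 / 2 * sqrt \<kappa>) / 2) \<le> real k * (s / 2)"
    using k(2) \<kappa> s by (intro mult_mono) auto
  moreover have "(6 * sqrt \<kappa> * ln \<kappa>) * (1 / (3 / 2 * sqrt \<kappa>) / 2) = 2 * ln \<kappa>"
    using \<kappa> by (simp add: field_simps)
  ultimately have "2 * ln \<kappa> \<le> real k * (s / 2)" by simp
  also have "\<dots> \<le> real k * ln (1 + s)"
    using half_le_ln_one_plus[OF s] by (intro mult_left_mono) auto
  finally have "ln (\<kappa>\<^sup>2) \<le> ln ((1 + s) ^ k)" using \<kappa> s by (simp add: ln_realpow)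
  then have "\<kappa>\<^sup>2 \<le> (1 + s) ^ k" using \<kappa> s by (subst (asm) ln_le_cancel_iff) auto
  moreover have "\<kappa> * L \<le> \<kappa>\<^sup>2" using L \<kappa> by (simp add: power2_eq_square)
  ultimately have "\<kappa> \<le> (1 + s) ^ k / L" using L by (simp add: field_simps)
  also have "\<dots> \<le> weight c (Suc k)"
    unfolding weight_def s_def L_def using L_bounds by (intro acg_A_exponential_growth) auto
  finally show ?thesis by (simp add: k)
qed

lemma step1_endsD:
  assumes c: "c \<in> D" and ends: "aipp_step1_ends n g h M l \<sigma> c j"
  shows "j > 0" and "weight c j \<ge> 18" and "aipp_accepts n g h l \<sigma> c (aipp_triple n g h M l c j)"
    and "j \<le> step1_cap"
proof -
  let ?P = "\<lambda>j. int j \<ge> \<lceil>6 * sqrt (2 * l * M + 1)\<rceil> \<and>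
                   aipp_accepts n g h l \<sigma> c (aipp_triple n g h M l c j)"
  have first: "is_first ?P j" using ends by (simp add: aipp_step1_ends_def)
  then have "?P j" by (simp add: is_first_def)
  then show "j > 0" "weight c j \<ge> 18" "aipp_accepts n g h l \<sigma> c (aipp_triple n g h M l c j)"
    using weight_min_iterations by auto
  have "?P step1_cap"
    using step1_cap_min_iterations aipp_iterate_accepted[OF c step1_cap_pos \<sigma> weight_after_step1_cap] by simp
  with first show "j \<le> step1_cap" by (rule is_first_le)
qed

lemma step1_ends_exists:
  assumes c: "c \<in> D"
  obtains j where "aipp_step1_ends n g h M l \<sigma> c j"
  using is_first_exists[of "\<lambda>j. int j \<ge> \<lceil>6 * sqrt (2 * l * M + 1)\<rceil> \<and>
      aipp_accepts n g h l \<sigma> c (aipp_triple n g h M l c j)" step1_cap]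
    step1_cap_min_iterations aipp_iterate_accepted[OF c step1_cap_pos \<sigma> weight_after_step1_cap[OF order_refl]]
  unfolding aipp_step1_ends_def by blast

abbreviation step3_test :: "rseq \<Rightarrow> nat \<Rightarrow> nat \<Rightarrow> bool"
  where "step3_test c j i \<equiv> i \<ge> j \<and> aipp_accepts n g h l \<sigma> c (aipp_triple n g h M l c i) \<and>
    snd (snd (aipp_triple n g h M l c i)) / l \<le> \<epsilon>"

text \<open>
  By stability of the residual, \<open>\<eta>\<close> times the weight is at most a constant multiple of
  \<open>(l \<rho>)^2\<close>, so a weight of \<open>\<kappa>\<close> brings \<open>\<eta> / l\<close> below the tolerance.
\<close>
lemma step3_succeeds:
  assumes c: "c \<in> D" and ends: "aipp_step1_ends n g h M l \<sigma> c j"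
    and t: "aipp_triple n g h M l c j = (x, u, \<eta>)" and small: "norm (c - x + u) \<le> l * \<rho> / 5"
  shows "step3_test c j (step1_cap + step3_cap)"
proof -
  note j = step1_endsD[OF c ends]
  obtain x' u' \<eta>' where t': "aipp_triple n g h M l c (step1_cap + step3_cap) = (x', u', \<eta>')" by (metis prod_cases3)
  have pos: "step1_cap + step3_cap > 0" using step1_cap_pos by simp
  have A: "weight c (step1_cap + step3_cap) \<ge> 18 / \<sigma>" by (rule weight_after_step1_cap) simp
  have "18 \<le> 18 / \<sigma>" using \<sigma> by (simp add: field_simps)
  with A have A18: "weight c (step1_cap + step3_cap) \<ge> 18" by linarith
  have "\<eta>' \<ge> 0" using aipp_triple_properties(3)[OF c pos t'] .
  then have "\<kappa> * \<eta>' \<le> weight c (step1_cap + step3_cap) * \<eta>'" using weight_at_both_caps by (intro mult_right_mono)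
  also have "\<dots> \<le> 6 * (norm (c - x + u))\<^sup>2"
    by (rule aipp_residual_stable(2)[OF c j(1,2) t pos A18 t'])
  also have "\<dots> \<le> 6 * (l * \<rho> / 5)\<^sup>2" using small by (intro mult_left_mono power_mono) auto
  finally have "\<eta>' \<le> 6 * (l * \<rho> / 5)\<^sup>2 / \<kappa>" using \<kappa> by (simp add: field_simps)
  then have "\<eta>' / l \<le> 6 * (l * \<rho> / 5)\<^sup>2 / \<kappa> / l" using l by (intro divide_right_mono) auto
  also have "\<dots> = 6 * \<rho>_hat\<^sup>2 / (800 * M)"
    using mM by (simp add: l_eq \<rho>_eq \<kappa>_def power2_eq_square field_simps)
  also have "\<dots> \<le> \<rho>_hat\<^sup>2 / (96 * M)"
    using mM by (simp add: field_simps)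
  also have "\<dots> \<le> \<epsilon>" unfolding \<epsilon>_eq using mM by (intro divide_left_mono) auto
  finally show ?thesis
    using aipp_iterate_accepted[OF c pos \<sigma> A] j(4) by (simp add: t')
qed

section \<open>Outer iterations\<close>

text \<open>
  The approximate subgradient inequality at \<open>w\<close>, with the square completed in the residual; the
  acceptance test pays for \<open>|u|^2 / 2 + \<eta>\<close> out of the residual and leaves the fraction \<open>1 - \<sigma>\<close> of it.
\<close>
lemma accepted_decrease:
  assumes c: "c \<in> D" and j: "j > 0" and t: "aipp_triple n g h M l c j = (x, u, \<eta>)"
    and acc: "aipp_accepts n g h l \<sigma> c (x, u, \<eta>)" and w: "w \<in> D"
  shows "l * \<phi> x + (1 - \<sigma>) / 2 * (norm (c - x + u))\<^sup>2
    \<le> l * \<phi> w + 1 / 2 * (norm (w - c))\<^sup>2 - u \<bullet> (w - c)"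
proof -
  have le: "(norm u)\<^sup>2 + 2 * \<eta> \<le> \<sigma> * (norm (c - x + u))\<^sup>2"
    using acc aipp_accepts_iff[OF c j t] by simp
  have "prox_obj c x + u \<bullet> (w - x) - \<eta> \<le> prox_obj c w"
    by (rule aipp_triple_properties(5)[OF c j t w])
  moreover have "1 / 2 * (norm (x - c))\<^sup>2 + u \<bullet> (w - x)
      = 1 / 2 * (norm (c - x + u))\<^sup>2 - 1 / 2 * (norm u)\<^sup>2 + u \<bullet> (w - c)"
    by (simp add: power2_norm_eq_inner inner_commute algebra_simps)
  moreover have "(1 - \<sigma>) / 2 * (norm (c - x + u))\<^sup>2
      = 1 / 2 * (norm (c - x + u))\<^sup>2 - \<sigma> * (norm (c - x + u))\<^sup>2 / 2"
    by (simp add: field_simps)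
  ultimately show ?thesis using le unfolding prox_obj_def by linarith
qed

lemma accepted_descent:
  assumes "c \<in> D" "j > 0" "aipp_triple n g h M l c j = (x, u, \<eta>)" "aipp_accepts n g h l \<sigma> c (x, u, \<eta>)"
  shows "l * \<phi> x + (1 - \<sigma>) / 2 * (norm (c - x + u))\<^sup>2 \<le> l * \<phi> c"
  using accepted_decrease[OF assms assms(1)] by simp

text \<open>
  The residual that the acceptance test leaves over absorbs \<open>u \<bullet> (w - c)\<close> by Young's inequality with
  parameter \<open>1 - \<sigma>\<close>. Used for the first outer iteration, it replaces the initial objective gap, up
  to a factor depending on \<open>\<sigma>\<close>, by the quantity that \<open>R_phi\<close> minimizes over \<open>w\<close>.
\<close>
lemma accepted_first:
  assumes c: "c \<in> D" and j: "j > 0" and t: "aipp_triple n g h M l c j = (x, u, \<eta>)"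
    and acc: "aipp_accepts n g h l \<sigma> c (x, u, \<eta>)" and w: "w \<in> D"
  shows "l * \<phi> x \<le> l * \<phi> w + 1 / (1 - \<sigma>) * (norm (w - c))\<^sup>2"
proof -
  define r where "r = 1 - \<sigma>"
  have r: "0 < r" "r < 1" using \<sigma> by (auto simp: r_def)
  have "(norm u)\<^sup>2 + 2 * \<eta> \<le> \<sigma> * (norm (c - x + u))\<^sup>2"
    using acc aipp_accepts_iff[OF c j t] by simp
  moreover have "\<sigma> * (norm (c - x + u))\<^sup>2 \<le> 1 * (norm (c - x + u))\<^sup>2"
    using \<sigma> by (intro mult_right_mono) auto
  ultimately have "(norm u)\<^sup>2 \<le> (norm (c - x + u))\<^sup>2"
    using aipp_triple_properties(3)[OF c j t] by linarith
  then have u: "r / 2 * (norm u)\<^sup>2 \<le> r / 2 * (norm (c - x + u))\<^sup>2" using r by simp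
  have "0 \<le> 1 / (2 * r) * (norm (r *\<^sub>R u + (w - c)))\<^sup>2" using r by simp
  also have "\<dots> = r / 2 * (norm u)\<^sup>2 + u \<bullet> (w - c) + 1 / (2 * r) * (norm (w - c))\<^sup>2"
  proof -
    have "(norm (r *\<^sub>R u + (w - c)))\<^sup>2 = r * r * (norm u)\<^sup>2 + 2 * r * (u \<bullet> (w - c)) + (norm (w - c))\<^sup>2"
      by (simp add: power2_norm_eq_inner inner_commute algebra_simps)
    then show ?thesis using r by (simp add: field_simps)
  qed
  finally have young: "- (u \<bullet> (w - c)) \<le> r / 2 * (norm u)\<^sup>2 + 1 / (2 * r) * (norm (w - c))\<^sup>2"
    by linarith
  have "1 / 2 * (norm (w - c))\<^sup>2 \<le> 1 / (2 * r) * (norm (w - c))\<^sup>2"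
    using r by (intro mult_right_mono) (auto simp: field_simps)
  with accepted_decrease[OF assms] u young
  have "l * \<phi> x \<le> l * \<phi> w + 2 * (1 / (2 * r) * (norm (w - c))\<^sup>2)"
    unfolding r_def[symmetric] by linarith
  also have "2 * (1 / (2 * r) * (norm (w - c))\<^sup>2) = 1 / r * (norm (w - c))\<^sup>2" by simp
  finally show ?thesis by (simp add: r_def)
qed

text \<open>
  The gain is measured against an arbitrary comparison point \<open>w\<close>, since \<open>R_phi\<close> is an infimum over
  all such points.
\<close>
definition outer_progress :: "nat \<Rightarrow> rseq \<Rightarrow> bool"
  where "outer_progress k c \<longleftrightarrow>
    (\<forall>w\<in>D. real k * outer_gain + l * \<phi> c \<le> l * \<phi> w + 1 / (1 - \<sigma>) * (norm (w - z0))\<^sup>2)"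

lemma outer_step:
  assumes c: "c \<in> D" and ends: "aipp_step1_ends n g h M l \<sigma> c j"
    and t: "aipp_triple n g h M l c j = (x, u, \<eta>)"
  shows "x \<in> D"
    and outer_step_first: "c = z0 \<Longrightarrow> outer_progress 0 x"
    and outer_step_later: "norm (c - x + u) > l * \<rho> / 5 \<Longrightarrow> outer_progress k c \<Longrightarrow> outer_progress (Suc k) x"
proof -
  note j = step1_endsD[OF c ends]
  have acc: "aipp_accepts n g h l \<sigma> c (x, u, \<eta>)" using j(3) t by simp
  show "x \<in> D" by (rule aipp_triple_properties(1)[OF c j(1) t])
  show "outer_progress 0 x" if "c = z0"
    using accepted_first[OF c j(1) t acc] that by (simp add: outer_progress_def)
  show "outer_progress (Suc k) x" if big: "norm (c - x + u) > l * \<rho> / 5" and k: "outer_progress k c"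
  proof -
    have "outer_gain \<le> (1 - \<sigma>) / 2 * (norm (c - x + u))\<^sup>2"
      unfolding outer_gain_def using big l\<rho> \<sigma> by (intro mult_left_mono power_mono) auto
    with accepted_descent[OF c j(1) t acc] have "outer_gain + l * \<phi> x \<le> l * \<phi> c" by linarith
    with k show ?thesis by (force simp: outer_progress_def algebra_simps)
  qed
qed

text \<open>
  The first outer iteration earns nothing in \<open>outer_progress\<close>, so \<open>k\<close> gains correspond to \<open>k + 1\<close>
  runs of Step 1.
\<close>
lemma reaches_progress:
  assumes "aipp_reaches n g h M l \<sigma> \<rho> z0 c N"
  shows "c \<in> D \<and> (c = z0 \<and> N = 0 \<or> (\<exists>k. N \<le> (k + 1) * step1_cap \<and> outer_progress k c))"
  using assms
proof induction
  case start
  show ?case using z0 by simp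
next
  case (continue c N j x u \<eta>)
  then have c: "c \<in> D" by simp
  note step = outer_step[OF c continue.hyps(2,3)] and j = step1_endsD(4)[OF c continue.hyps(2)]
  show ?case
  proof (cases "c = z0 \<and> N = 0")
    case True
    then have "N + j \<le> (0 + 1) * step1_cap" "outer_progress 0 x" using step j by auto
    then show ?thesis using step(1) by blast
  next
    case False
    then obtain k where "N \<le> (k + 1) * step1_cap" "outer_progress k c" using continue.IH by blast
    then have "N + j \<le> (Suc k + 1) * step1_cap" "outer_progress (Suc k) x"
      using step(3) continue.hyps(4) j by auto
    then show ?thesis using step(1) by blast
  qed
qed

lemma phi_inf_finite:
  obtains \<phi>s where "phi_inf n g h = ereal \<phi>s" "\<And>w. w \<in> D \<Longrightarrow> \<phi>s \<le> \<phi> w"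
proof -
  have le: "phi_inf n g h \<le> ereal (\<phi> w)" if "w \<in> D" for w
    unfolding phi_inf_def using INF_lower[OF D_Rn[OF that], of "phi g h"] by (simp add: phi_eq[OF that])
  have "phi_inf n g h \<noteq> - \<infinity>" using A3 by (simp add: A3_def)
  moreover have "phi_inf n g h \<noteq> \<infinity>" using le[OF z0] by auto
  ultimately obtain \<phi>s where \<phi>s: "phi_inf n g h = ereal \<phi>s" by (cases "phi_inf n g h") auto
  with le that show ?thesis by simp
qed

lemma outer_gain_pos: "outer_gain > 0"
  unfolding outer_gain_def using \<sigma> l\<rho> by (intro mult_pos_pos zero_less_power) auto

text \<open>
  Without an output the method continues forever, and \<open>k\<close> gains for every \<open>k\<close> push \<open>l \<phi>\<close> below
  its infimum.
\<close>
lemma output_exists: "\<exists>out N. aipp_outputs n g h M l \<sigma> \<rho> \<epsilon> z0 out N"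
proof (rule ccontr)
  assume no: "\<nexists>out N. aipp_outputs n g h M l \<sigma> \<rho> \<epsilon> z0 out N"
  have advance: "\<exists>j x u \<eta>. aipp_step1_ends n g h M l \<sigma> c j \<and> aipp_triple n g h M l c j = (x, u, \<eta>) \<and>
      norm (c - x + u) > l * \<rho> / 5" if reach: "aipp_reaches n g h M l \<sigma> \<rho> z0 c N" for c N
  proof -
    have c: "c \<in> D" using reaches_progress[OF reach] by simp
    obtain j where ends: "aipp_step1_ends n g h M l \<sigma> c j" using step1_ends_exists[OF c] by blast
    obtain x u \<eta> where t: "aipp_triple n g h M l c j = (x, u, \<eta>)" by (metis prod_cases3)
    have "norm (c - x + u) > l * \<rho> / 5"
    proof (rule ccontr)
      assume "\<not> norm (c - x + u) > l * \<rho> / 5"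
      then have small: "norm (c - x + u) \<le> l * \<rho> / 5" by simp
      obtain j' where j': "is_first (step3_test c j) j'"
        using is_first_exists[of "step3_test c j", OF step3_succeeds[OF c ends t small]] by blast
      obtain z v e where "aipp_triple n g h M l c j' = (z, v, e)" by (metis prod_cases3)
      from aipp_outputs.stop[OF reach ends t small j' this] no show False by blast
    qed
    with ends t show ?thesis by blast
  qed
  have "\<exists>c N. aipp_reaches n g h M l \<sigma> \<rho> z0 c N \<and> outer_progress k c" for k
  proof (induction k)
    case 0
    have start: "aipp_reaches n g h M l \<sigma> \<rho> z0 z0 0" by (rule aipp_reaches.start)
    obtain j x u \<eta> where step: "aipp_step1_ends n g h M l \<sigma> z0 j"
        "aipp_triple n g h M l z0 j = (x, u, \<eta>)" "norm (z0 - x + u) > l * \<rho> / 5"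
      using advance[OF start] by blast
    show ?case
      using aipp_reaches.continue[OF start step] outer_step_first[OF z0 step(1,2)] by blast
  next
    case (Suc k)
    then obtain c N where c: "aipp_reaches n g h M l \<sigma> \<rho> z0 c N" "outer_progress k c" by blast
    obtain j x u \<eta> where step: "aipp_step1_ends n g h M l \<sigma> c j"
        "aipp_triple n g h M l c j = (x, u, \<eta>)" "norm (c - x + u) > l * \<rho> / 5"
      using advance[OF c(1)] by blast
    have "c \<in> D" using reaches_progress[OF c(1)] by simp
    then show ?case
      using aipp_reaches.continue[OF c(1) step] outer_step_later[OF _ step c(2)] by blast
  qed
  moreover obtain \<phi>s where \<phi>s: "\<And>w. w \<in> D \<Longrightarrow> \<phi>s \<le> \<phi> w" using phi_inf_finite by blast
  moreover obtain k :: nat where k: "l * (\<phi> z0 - \<phi>s) < real k * outer_gain"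
    using reals_Archimedean3[OF outer_gain_pos] by blast
  ultimately obtain c N where c: "aipp_reaches n g h M l \<sigma> \<rho> z0 c N" "outer_progress k c" by blast
  have "c \<in> D" using reaches_progress[OF c(1)] by simp
  then have "l * \<phi>s \<le> l * \<phi> c" using \<phi>s l by simp
  moreover have "real k * outer_gain + l * \<phi> c \<le> l * \<phi> z0" using c(2) z0 by (force simp: outer_progress_def)
  ultimately show False using k by (simp add: algebra_simps)
qed

lemma outputs_cases:
  assumes "aipp_outputs n g h M l \<sigma> \<rho> \<epsilon> z0 (l', c, z, w, e) N"
  obtains N0 j x u \<eta> j' v e' where "N = N0 + j'"
    "aipp_reaches n g h M l \<sigma> \<rho> z0 c N0" "aipp_step1_ends n g h M l \<sigma> c j"
    "aipp_triple n g h M l c j = (x, u, \<eta>)" "norm (c - x + u) \<le> l * \<rho> / 5"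
    "is_first (step3_test c j) j'" "aipp_triple n g h M l c j' = (z, v, e')"
  using assms by (cases rule: aipp_outputs.cases) blast

text \<open>
  At most \<open>k + 2\<close> runs of Step 1 and one of Step 3 take place, where \<open>k * outer_gain\<close> is bounded by
  \<open>2 / (1 - \<sigma>)\<close> times the value at \<open>w\<close> of the function whose infimum is \<open>R_phi\<close>.
\<close>
lemma outputs_count:
  assumes out: "aipp_outputs n g h M l \<sigma> \<rho> \<epsilon> z0 out N"
    and \<phi>s: "\<And>w. w \<in> D \<Longrightarrow> \<phi>s \<le> \<phi> w" and w: "w \<in> D"
  shows "real N \<le> aipp_constant \<sigma> * sqrt \<kappa> *
    (m\<^sup>2 * (1 / 2 * (norm (z0 - w))\<^sup>2 + (1 - \<sigma>) * l * (\<phi> w - \<phi>s)) / \<rho>_hat\<^sup>2 + log1_plus \<kappa>)"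
proof -
  define G where "G = 1 / 2 * (norm (z0 - w))\<^sup>2 + (1 - \<sigma>) * l * (\<phi> w - \<phi>s)"
  define X where "X = m\<^sup>2 * G / \<rho>_hat\<^sup>2"
  define B where "B = 6400 / (1 - \<sigma>)\<^sup>2"
  have "(1 - \<sigma>) * l * (\<phi> w - \<phi>s) \<ge> 0" using \<sigma> l \<phi>s[OF w] by simp
  then have G: "G \<ge> 0" by (simp add: G_def)
  then have X: "X \<ge> 0" by (simp add: X_def)
  have B: "B \<ge> 0" by (simp add: B_def)
  obtain l' c z w' e where out_eq: "out = (l', c, z, w', e)" by (metis prod_cases5)
  obtain N0 j x u \<eta> j' v e' where o: "N = N0 + j'"
    "aipp_reaches n g h M l \<sigma> \<rho> z0 c N0" "aipp_step1_ends n g h M l \<sigma> c j"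
    "aipp_triple n g h M l c j = (x, u, \<eta>)" "norm (c - x + u) \<le> l * \<rho> / 5"
    "is_first (step3_test c j) j'" "aipp_triple n g h M l c j' = (z, v, e')"
    using out[unfolded out_eq] by (rule outputs_cases)
  have c: "c \<in> D" using reaches_progress[OF o(2)] by simp
  have j': "j' \<le> step1_cap + step3_cap" by (rule is_first_le[OF o(6) step3_succeeds[OF c o(3-5)]])
  have "\<exists>k. real k \<le> B * X \<and> N0 \<le> (k + 1) * step1_cap"
  proof (cases "c = z0 \<and> N0 = 0")
    case True
    then show ?thesis using B X by (intro exI[of _ 0]) simp
  next
    case False
    then obtain k where k: "N0 \<le> (k + 1) * step1_cap" "outer_progress k c"
      using reaches_progress[OF o(2)] by blast
    have "l * \<phi>s \<le> l * \<phi> c" using \<phi>s[OF c] l by simp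
    then have "real k * outer_gain \<le> l * (\<phi> w - \<phi>s) + 1 / (1 - \<sigma>) * (norm (w - z0))\<^sup>2"
      using k(2) w by (force simp: outer_progress_def algebra_simps)
    also have "\<dots> \<le> 2 * (l * (\<phi> w - \<phi>s)) + 1 / (1 - \<sigma>) * (norm (w - z0))\<^sup>2"
      using l \<phi>s[OF w] by simp
    also have "\<dots> = 2 / (1 - \<sigma>) * G"
      using \<sigma> by (simp add: G_def norm_minus_commute field_simps)
    finally have "real k \<le> 2 / (1 - \<sigma>) * G / outer_gain" by (rule mult_imp_le_div_pos[OF outer_gain_pos])
    also have "\<dots> = B * X"
    proof -
      define r where "r = 1 - \<sigma>"
      have l\<rho>_eq: "l * \<rho> / 5 = \<rho>_hat / (40 * m)" by (simp add: l_eq \<rho>_eq)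
      have outer_gain_eq: "outer_gain = r / 2 * (\<rho>_hat\<^sup>2 / (1600 * m\<^sup>2))"
        unfolding outer_gain_def l\<rho>_eq r_def by (simp add: power_divide power_mult_distrib)
      have "r > 0" using \<sigma> by (simp add: r_def)
      then show ?thesis
        using mM \<rho>_hat unfolding B_def X_def outer_gain_eq r_def[symmetric]
        by (simp add: power2_eq_square field_simps)
    qed
    finally show ?thesis using k(1) by blast
  qed
  then obtain k where k: "real k \<le> B * X" "N0 \<le> (k + 1) * step1_cap" by blast
  have "N \<le> (k + 2) * step1_cap + step3_cap" using k(2) j' o(1) by simp
  then have "real N \<le> (real k + 2) * real step1_cap + real step3_cap"
    by (metis (mono_tags) of_nat_add of_nat_le_iff of_nat_mult of_nat_numeral)
  also have "\<dots> \<le> (B * X + 2) * (10 * sqrt \<kappa> / \<sigma>) + 7 * sqrt \<kappa> * log1_plus \<kappa>"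
    using k(1) step1_cap_upper step3_cap_upper B X by (intro add_mono mult_mono) auto
  also have "\<dots> = sqrt \<kappa> * (10 * B / \<sigma> * X + 20 / \<sigma> * 1 + 7 * log1_plus \<kappa>)"
    using \<sigma> by (simp add: field_simps)
  also have "\<dots> \<le> sqrt \<kappa> * (aipp_constant \<sigma> * X + aipp_constant \<sigma> * log1_plus \<kappa>)"
  proof (rule mult_left_mono)
    have log1: "log1_plus \<kappa> \<ge> 1" by (simp add: log1_plus_def)
    have "10 * B / \<sigma> * X \<le> aipp_constant \<sigma> * X"
      using X \<sigma> by (intro mult_right_mono) (auto simp: aipp_constant_def B_def)
    moreover have "20 / \<sigma> * 1 \<le> 20 / \<sigma> * log1_plus \<kappa>"
      using log1 \<sigma> by (intro mult_left_mono) auto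
    moreover have "(20 / \<sigma> + 7) * log1_plus \<kappa> \<le> aipp_constant \<sigma> * log1_plus \<kappa>"
      using log1 \<sigma> by (intro mult_right_mono) (auto simp: aipp_constant_def)
    ultimately show "10 * B / \<sigma> * X + 20 / \<sigma> * 1 + 7 * log1_plus \<kappa> \<le> aipp_constant \<sigma> * X + aipp_constant \<sigma> * log1_plus \<kappa>"
      by (simp add: distrib_right)
  qed (use \<kappa> in simp)
  finally show ?thesis by (simp add: X_def G_def algebra_simps)
qed

lemma outputs_complexity:
  assumes out: "aipp_outputs n g h M l \<sigma> \<rho> \<epsilon> z0 out N"
  shows "ereal (real N) \<le> ereal (aipp_constant \<sigma> * sqrt (M / m)) *
    (ereal (m\<^sup>2) * R_phi n g h \<sigma> z0 l / ereal (\<rho>_hat\<^sup>2) + ereal (log1_plus (M / m)))"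
proof -
  obtain \<phi>s where \<phi>s: "phi_inf n g h = ereal \<phi>s" "\<And>w. w \<in> D \<Longrightarrow> \<phi>s \<le> \<phi> w"
    using phi_inf_finite by blast
  let ?G = "\<lambda>w. 1 / 2 * (norm (z0 - w))\<^sup>2 + (1 - \<sigma>) * l * (\<phi> w - \<phi>s)"
  let ?F = "\<lambda>u. ereal (1 / 2 * (norm (z0 - u))\<^sup>2)
    + ereal ((1 - \<sigma>) * l) * (phi g h u - phi_inf n g h)"
  have F: "?F w = ereal (?G w)" if "w \<in> D" for w
    using that by (simp add: phi_eq \<phi>s(1))
  have coeff: "(1 - \<sigma>) * l > 0" using \<sigma> l by simp
  have F_out: "?F w = \<infinity>" if "w \<in> Rn n" "w \<notin> D" for w
    using coeff \<sigma> l phi_outside[OF that] by (simp add: \<phi>s(1))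
  have C: "aipp_constant \<sigma> * sqrt \<kappa> > 0"
    using \<sigma> \<kappa> by (auto simp: aipp_constant_def intro!: mult_pos_pos add_nonneg_pos add_nonneg_nonneg)
  \<comment> \<open>\<open>r\<close> is the count bound solved for \<open>R_phi\<close>, so that the bounds for all \<open>w\<close> say \<open>r \<le> R_phi\<close>\<close>
  define r where "r = (real N / (aipp_constant \<sigma> * sqrt \<kappa>) - log1_plus \<kappa>) * \<rho>_hat\<^sup>2 / m\<^sup>2"
  have "r \<le> ?G w" if "w \<in> D" for w
  proof -
    have "real N / (aipp_constant \<sigma> * sqrt \<kappa>) \<le> m\<^sup>2 * ?G w / \<rho>_hat\<^sup>2 + log1_plus \<kappa>"
      using outputs_count[OF out \<phi>s(2) that] C by (simp add: pos_divide_le_eq mult.commute)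
    then have "real N / (aipp_constant \<sigma> * sqrt \<kappa>) - log1_plus \<kappa> \<le> m\<^sup>2 * ?G w / \<rho>_hat\<^sup>2" by linarith
    then have "(real N / (aipp_constant \<sigma> * sqrt \<kappa>) - log1_plus \<kappa>) * \<rho>_hat\<^sup>2 \<le> m\<^sup>2 * ?G w"
      using \<rho>_hat by (simp add: pos_le_divide_eq)
    then show ?thesis using mM by (simp add: r_def pos_divide_le_eq mult.commute)
  qed
  then have r_le: "ereal r \<le> R_phi n g h \<sigma> z0 l"
    unfolding R_phi_def
  proof (intro INF_greatest)
    fix w assume *: "\<And>w. w \<in> D \<Longrightarrow> r \<le> ?G w" and w: "w \<in> Rn n"
    show "ereal r \<le> ?F w"
    proof (cases "w \<in> D")
      case True
      show ?thesis unfolding F[OF True] using *[OF True] by simp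
    next
      case False
      show ?thesis unfolding F_out[OF w False] by simp
    qed
  qed
  moreover have "R_phi n g h \<sigma> z0 l \<le> ereal (?G z0)"
    unfolding R_phi_def F[OF z0, symmetric] by (rule INF_lower[OF D_Rn[OF z0]])
  ultimately obtain R where R: "R_phi n g h \<sigma> z0 l = ereal R" by (cases "R_phi n g h \<sigma> z0 l") auto
  with r_le have "r \<le> R" by simp
  then have "(real N / (aipp_constant \<sigma> * sqrt \<kappa>) - log1_plus \<kappa>) * \<rho>_hat\<^sup>2 \<le> m\<^sup>2 * R"
    using mM by (simp add: r_def pos_divide_le_eq mult.commute)
  then have "real N / (aipp_constant \<sigma> * sqrt \<kappa>) - log1_plus \<kappa> \<le> m\<^sup>2 * R / \<rho>_hat\<^sup>2"
    using \<rho>_hat by (simp add: pos_le_divide_eq)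
  then have "real N / (aipp_constant \<sigma> * sqrt \<kappa>) \<le> m\<^sup>2 * R / \<rho>_hat\<^sup>2 + log1_plus \<kappa>" by linarith
  then have "real N \<le> aipp_constant \<sigma> * sqrt \<kappa> * (m\<^sup>2 * R / \<rho>_hat\<^sup>2 + log1_plus \<kappa>)"
    using C by (simp add: pos_divide_le_eq mult.commute)
  then show ?thesis using \<rho>_hat by (simp add: R \<kappa>_def)
qed

section \<open>The refined pair\<close>

text \<open>
  The factor \<open>15/4\<close> of residual stability turns the Step 1 threshold \<open>l \<rho> / 5\<close> into
  \<open>3/4 l \<rho> = 3/16 l \<rho>_hat\<close> for the iterate that is returned.
\<close>
lemma outputs_residual:
  assumes out: "aipp_outputs n g h M l \<sigma> \<rho> \<epsilon> z0 (l', c, z, w, e) N"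
  obtains v e' where "c \<in> D" "z \<in> D" "norm (c - z + v) / l \<le> 3 / 16 * \<rho>_hat" "e' / l \<le> \<epsilon>"
    "\<And>w. w \<in> D \<Longrightarrow> prox_obj c z + v \<bullet> (w - z) - e' \<le> prox_obj c w"
proof -
  obtain N0 j x u \<eta> j' v e' where "N = N0 + j'" and o:
    "aipp_reaches n g h M l \<sigma> \<rho> z0 c N0" "aipp_step1_ends n g h M l \<sigma> c j"
    "aipp_triple n g h M l c j = (x, u, \<eta>)" "norm (c - x + u) \<le> l * \<rho> / 5"
    "is_first (step3_test c j) j'" "aipp_triple n g h M l c j' = (z, v, e')"
    using out by (rule outputs_cases)
  have c: "c \<in> D" using reaches_progress[OF o(1)] by simp
  have ge: "j' \<ge> j" "e' / l \<le> \<epsilon>" using o(5,6) by (auto simp: is_first_def)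
  have "int j \<ge> \<lceil>6 * sqrt (2 * l * M + 1)\<rceil>"
    using o(2) by (auto simp: aipp_step1_ends_def is_first_def)
  with ge have "int j' \<ge> \<lceil>6 * sqrt (2 * l * M + 1)\<rceil>" by linarith
  note j' = weight_min_iterations[OF this]
  have "norm (c - z + v) \<le> 15 / 4 * norm (c - x + u)"
    by (rule aipp_residual_stable(1)[OF c step1_endsD(1,2)[OF c o(2)] o(3) j' o(6)])
  with o(4) have "norm (c - z + v) \<le> 3 / 16 * \<rho>_hat * l" by (simp add: \<rho>_eq algebra_simps)
  then have "norm (c - z + v) / l \<le> 3 / 16 * \<rho>_hat" using l by (simp add: pos_divide_le_eq)
  with c ge(2) aipp_triple_properties[OF c j'(1) o(6)] that show ?thesis by blast
qed

text \<open>
  Write \<open>P = |zg - z|\<close> and \<open>T = M + 1/l\<close>. The growth of the refinement problem and the upper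
  curvature of \<open>g\<close> show that passing to \<open>zg\<close> lowers \<open>\<phi>\<close> by at least \<open>(M/2 + 1/l) P^2\<close>, while
  the approximate subgradient inequality of the output limits any such decrease. With the
  tolerances of the method the resulting quadratic inequality for \<open>T P\<close> has exactly
  \<open>\<rho>_hat / 2\<close> as its positive root, and the gradient difference adds at most another \<open>T P\<close>.
\<close>
lemma refinement:
  assumes out: "aipp_outputs n g h M l \<sigma> \<rho> \<epsilon> z0 (l', c, z, w, e) N"
    and lip: "M-lipschitz_on D (grad n g)"
  shows "v_refined n g h M l z \<in> (\<lambda>s. grad n g (z_refined n g h M l z) + s) `
      subdifferential n h (z_refined n g h M l z)"
    and "norm (v_refined n g h M l z) \<le> \<rho>_hat"
proof -
  define T where "T = M + 1 / l"
  define zg where "zg = z_refined n g h M l z"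
  define p where "p = (\<lambda>u. linearization n g u z + fin_part h u + T / 2 * (norm (u - z))\<^sup>2)"
  obtain v e' where c: "c \<in> D" and z: "z \<in> D" and r: "norm (c - z + v) / l \<le> 3 / 16 * \<rho>_hat"
    and e': "e' / l \<le> \<epsilon>"
    and sub: "\<And>w. w \<in> D \<Longrightarrow> prox_obj c z + v \<bullet> (w - z) - e' \<le> prox_obj c w"
    using outputs_residual[OF out] by blast
  have T_eq: "T = M + 2 * m" by (simp add: T_def l_eq)
  have T: "T > 0" using mM by (simp add: T_eq)
  have p_eq: "p = (\<lambda>u. 1 * fin_part h u + (grad n g z \<bullet> u + (g z - grad n g z \<bullet> z) + T / 2 * (norm (u - z))\<^sup>2))"
    by (simp add: p_def linearization_def fun_eq_iff algebra_simps)
  have T2: "T / 2 > 0" using T by simp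
  have p_sc: "strongly_convex_on (2 * (T / 2)) D p"
    unfolding p_eq by (rule regularized_min_quadratic(1)[OF A1 zero_less_one T2])
  have p_ex: "\<exists>y\<in>D. \<forall>u\<in>D. p y \<le> p u"
    unfolding p_eq by (rule regularized_min_quadratic(2)[OF A1 zero_less_one T2])
  have "zg \<in> D \<and> (\<forall>u\<in>D. p zg \<le> p u)"
    unfolding zg_def z_refined_def
    by (rule arg_min_on_ereal[OF eff_dom_subset _ _ p_ex])
      (auto simp: p_def T_def ereal_fin_part[OF A1] outside_eff_dom)
  then have zg: "zg \<in> D" and zg_min: "\<And>u. u \<in> D \<Longrightarrow> p zg \<le> p u" by auto
  have growth: "p zg + T / 2 * (norm (u - zg))\<^sup>2 \<le> p u" if "u \<in> D" for u
    using strongly_convex_min_growth[OF convex_eff_dom[OF A1] p_sc zg zg_min that] by simp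

  define s where "s = T *\<^sub>R (z - zg) - grad n g z"
  have v_eq: "v_refined n g h M l z = grad n g zg + s"
    by (simp add: v_refined_def Let_def zg_def[symmetric] s_def T_def algebra_simps)
  have sub_iff: "v \<in> subdifferential n h x \<longleftrightarrow>
      v \<in> Rn n \<and> x \<in> D \<and> (\<forall>w\<in>D. fin_part h x + v \<bullet> (w - x) - 0 \<le> fin_part h w)" for v x
    by (rule eps_subdifferential_iff[OF eff_dom_subset])
      (auto simp: ereal_fin_part[OF A1] outside_eff_dom)
  have "s \<in> subdifferential n h zg"
    unfolding sub_iff
  proof (intro conjI ballI)
    show "s \<in> Rn n"
      unfolding s_def using grad_in_Rn[OF D_Rn[OF z] g_differentiable[OF z]] D_Rn[OF z] D_Rn[OF zg]
      by (intro subspace_diff subspace_scale subspace_Rn)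
    show "zg \<in> D" by (rule zg)
    fix u assume u: "u \<in> D"
    show "fin_part h zg + s \<bullet> (u - zg) - 0 \<le> fin_part h u"
      using growth[OF u] unfolding p_def norm_sq_shift[of u z zg]
      by (simp add: s_def linearization_def algebra_simps)
  qed
  then show "v_refined n g h M l z \<in> (\<lambda>s. grad n g (z_refined n g h M l z) + s) `
      subdifferential n h (z_refined n g h M l z)"
    unfolding v_eq zg_def[symmetric] by (rule imageI)

  define P where "P = norm (zg - z)"
  have "\<phi> zg + (M / 2 + 1 / l) * P\<^sup>2 \<le> \<phi> z"
  proof -
    have "p zg + T / 2 * P\<^sup>2 \<le> p z" using growth[OF z] by (simp add: P_def norm_minus_commute)
    moreover have "p z = \<phi> z" by (simp add: p_def linearization_def \<phi>_def)
    moreover have "\<phi> zg \<le> p zg - T / 2 * P\<^sup>2 + M / 2 * P\<^sup>2"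
      using g_upper[OF z zg] by (simp add: p_def \<phi>_def P_def)
    moreover have "(M / 2 + 1 / l) * P\<^sup>2 = T / 2 * P\<^sup>2 + T / 2 * P\<^sup>2 - M / 2 * P\<^sup>2"
      using l by (simp add: T_def field_simps)
    ultimately show ?thesis by linarith
  qed
  then have "l * (\<phi> zg + (M / 2 + 1 / l) * P\<^sup>2) \<le> l * \<phi> z" using l by simp
  then have "l * \<phi> zg + (l * M / 2 + 1) * P\<^sup>2 \<le> l * \<phi> z" using l by (simp add: algebra_simps)
  moreover have "l * \<phi> z + (c - z + v) \<bullet> (zg - z) - e' \<le> l * \<phi> zg + 1 / 2 * P\<^sup>2"
    using sub[OF zg] unfolding prox_obj_def norm_sq_shift[of zg c z]
    by (simp add: P_def algebra_simps)
  moreover have "- ((c - z + v) \<bullet> (zg - z)) \<le> norm (c - z + v) * P"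
    using Cauchy_Schwarz_ineq2[of "c - z + v" "zg - z"] by (simp add: P_def)
  ultimately have "(l * M / 2 + 1 / 2) * P\<^sup>2 \<le> norm (c - z + v) * P + e'"
    by (simp add: algebra_simps)
  then have "(l * M / 2 + 1 / 2) * P\<^sup>2 / l \<le> (norm (c - z + v) * P + e') / l"
    using l by (intro divide_right_mono) auto
  moreover have "(l * M / 2 + 1 / 2) * P\<^sup>2 / l = T / 2 * P\<^sup>2"
    using l by (simp add: T_def field_simps)
  ultimately have "T / 2 * P\<^sup>2 \<le> norm (c - z + v) / l * P + e' / l"
    by (simp add: add_divide_distrib)
  also have "\<dots> \<le> 3 / 16 * \<rho>_hat * P + \<epsilon>"
    using r e' by (intro add_mono mult_right_mono) (auto simp: P_def)
  finally have "2 * T * (T / 2 * P\<^sup>2) \<le> 2 * T * (3 / 16 * \<rho>_hat * P + \<epsilon>)" using T by simp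
  also have "\<dots> = 3 / 8 * \<rho>_hat * (T * P) + \<rho>_hat\<^sup>2 / 16"
  proof -
    have "\<epsilon> = \<rho>_hat\<^sup>2 / (32 * T)" unfolding \<epsilon>_eq T_eq ..
    then show ?thesis using T by (simp add: field_simps)
  qed
  \<comment> \<open>the roots of the quadratic in \<open>T P\<close> are \<open>\<rho>_hat / 2\<close> and \<open>- \<rho>_hat / 8\<close>\<close>
  finally have "(T * P - \<rho>_hat / 2) * (T * P + \<rho>_hat / 8) \<le> 0"
    by (simp add: power2_eq_square algebra_simps)
  moreover have "T * P + \<rho>_hat / 8 > 0"
    using T \<rho>_hat by (intro add_nonneg_pos) (auto simp: P_def)
  ultimately have TP: "T * P \<le> \<rho>_hat / 2" by (simp add: mult_le_0_iff)
  have "norm (grad n g zg - grad n g z) \<le> M * P"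
    using lipschitz_onD[OF lip zg z] by (simp add: dist_norm P_def)
  also have "\<dots> \<le> T * P" using mM by (intro mult_right_mono) (auto simp: T_eq P_def)
  finally have "norm (T *\<^sub>R (z - zg) + (grad n g zg - grad n g z)) \<le> T * P + T * P"
    using norm_triangle_ineq[of "T *\<^sub>R (z - zg)" "grad n g zg - grad n g z"] T
    by (simp add: P_def norm_minus_commute)
  moreover have "v_refined n g h M l z = T *\<^sub>R (z - zg) + (grad n g zg - grad n g z)"
    by (simp add: v_eq s_def)
  ultimately have "norm (v_refined n g h M l z) \<le> T * P + T * P" by simp
  then show "norm (v_refined n g h M l z) \<le> \<rho>_hat" using TP by linarith
qed

end

section \<open>Complexity and accuracy of AIPP\<close>

theorem corollary3p7:
  shows "\<exists>C :: real \<Rightarrow> real.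
    \<forall>(n :: nat) (g :: rseq \<Rightarrow> real) (h :: rseq \<Rightarrow> ereal) (m :: real) (M :: real)
     (\<rho>_hat :: real) (z0 :: rseq) (\<sigma> :: real) (l :: real) (\<rho> :: real) (\<epsilon> :: real).
      n \<ge> 1 \<and> A1 n h \<and> A2 n g h m M \<and> A3 n g h \<and>
      \<rho>_hat > 0 \<and> z0 \<in> eff_dom n h \<and> 0 < \<sigma> \<and> \<sigma> < 1 \<and>
      l = 1 / (2 * m) \<and> \<rho> = \<rho>_hat / 4 \<and> \<epsilon> = \<rho>_hat\<^sup>2 / (32 * (M + 2 * m)) \<longrightarrow>
      (\<exists>out N. aipp_outputs n g h M l \<sigma> \<rho> \<epsilon> z0 out N) \<and>
      (\<forall>out N. aipp_outputs n g h M l \<sigma> \<rho> \<epsilon> z0 out N \<longrightarrow>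
        ereal (real N) \<le>
          ereal (C \<sigma> * sqrt (M / m)) *
            (ereal (m\<^sup>2) * R_phi n g h \<sigma> z0 l / ereal (\<rho>_hat\<^sup>2) + ereal (log1_plus (M / m)))) \<and>
      (M-lipschitz_on (eff_dom n h) (grad n g) \<longrightarrow>
        (\<forall>z_minus z w e N. aipp_outputs n g h M l \<sigma> \<rho> \<epsilon> z0 (l, z_minus, z, w, e) N \<longrightarrow>
          (let z_hat = z_refined n g h M l z; v_hat = v_refined n g h M l z
           in v_hat \<in> (\<lambda>s. grad n g z_hat + s) ` subdifferential n h z_hat \<and>
              norm v_hat \<le> \<rho>_hat)))"
proof (intro exI[of _ aipp_constant] allI impI, elim conjE)
  fix n g h m M \<rho>_hat z0 \<sigma> l \<rho> \<epsilon>
  assume asm: "A1 n h" "A2 n g h m M" "A3 n g h" "\<rho>_hat > (0::real)" "z0 \<in> eff_dom n h"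
    "0 < \<sigma>" "\<sigma> < (1::real)" "l = 1 / (2 * m)" "\<rho> = \<rho>_hat / 4" "\<epsilon> = \<rho>_hat\<^sup>2 / (32 * (M + 2 * m))"
  have "m > 0" using asm(2) by (simp add: A2_def)
  then interpret aipp_run n g h m M l \<rho>_hat \<sigma> \<rho> \<epsilon> z0
    using asm by unfold_locales auto
  show "(\<exists>out N. aipp_outputs n g h M l \<sigma> \<rho> \<epsilon> z0 out N) \<and>
      (\<forall>out N. aipp_outputs n g h M l \<sigma> \<rho> \<epsilon> z0 out N \<longrightarrow>
        ereal (real N) \<le>
          ereal (aipp_constant \<sigma> * sqrt (M / m)) *
            (ereal (m\<^sup>2) * R_phi n g h \<sigma> z0 l / ereal (\<rho>_hat\<^sup>2) + ereal (log1_plus (M / m)))) \<and>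
      (M-lipschitz_on (eff_dom n h) (grad n g) \<longrightarrow>
        (\<forall>z_minus z w e N. aipp_outputs n g h M l \<sigma> \<rho> \<epsilon> z0 (l, z_minus, z, w, e) N \<longrightarrow>
          (let z_hat = z_refined n g h M l z; v_hat = v_refined n g h M l z
           in v_hat \<in> (\<lambda>s. grad n g z_hat + s) ` subdifferential n h z_hat \<and>
              norm v_hat \<le> \<rho>_hat)))"
    using output_exists outputs_complexity refinement unfolding Let_def by blast
qed

end
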